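(* For each positive integer $n$, let $\lambda_n$ denote a partition of $n$ which maximizes the number of subpartitions among all partitions of $n$, and let $s(\lambda_n)$ be the number of subpartitions of $\lambda_n$. Then $$s(\lambda_n) = e^{\pi\sqrt{2n/3}-o(\sqrt{n})}\qquad\text{as } n\to\infty.$$ Moreover, the rescaled boundary functions $f_{\lambda_n}:\mathbb R\to\mathbb R$ converge uniformly on $\mathbb R$ as $n\to\infty$ to the function $$f(x)=\frac{2\sqrt 3}{\pi}\log\Big(2\cosh\Big(\frac{\pi}{2\sqrt 3}x\Big)\Big).$$
   Context: A partition of $n$ is a sequence $\lambda=(\lambda_1\ge\dots\ge\lambda_k)$ of positive integers with sum $n$. A subpartition of $\lambda$ is a partition $\mu=(\mu_1\ge\dots\ge\mu_\ell)$ (of some integer) with $\ell\le k$ and $\mu_i\le\lambda_i$ for all $i\le \ell$; the empty partition ($\ell=0$) and $\lambda$ itself are counted as subpartitions. Boundary function (Russian convention): draw the Young diagram of $\lambda$ in English convention (left-justified rows of unit boxes, $\lambda_1$ boxes on top, then $\lambda_2$ below, etc.), rotate it by $135^\circ$ and place it immediately adjacent to the graph of $x\mapsto|x|$, each box having unit side length. Explicitly, the box in row $i$ and column $j$ ($1\le j\le\lambda_i$) becomes the square $\{(\frac{s-t}{\sqrt2},\frac{s+t}{\sqrt2}): i-1\le s\le i,\ j-1\le t\le j\}$. Let $D_\lambda$ be the union of these squares and of the graph of $|x|$, and let $g_\lambda(x)=\max\{y:(x,y)\in D_\lambda\}$. Then $g_\lambda$ is $1$-Lipschitz, $g_\lambda(x)\ge|x|$,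 and $g_\lambda(x)=|x|$ for large $|x|$. For $\lambda$ a partition of $n$, the rescaled function is $f_\lambda(x)=n^{-1/2}g_\lambda(n^{1/2}x)$, so that $\int_{\mathbb R}(f_\lambda(x)-|x|)\,dx=1$. Here $o(\sqrt n)$ denotes a quantity $r_n$ with $r_n/\sqrt n\to0$ as $n\to\infty$. *)

theory Defs
  imports "HOL-Analysis.Analysis" "HOL-Library.Landau_Symbols"
begin

definition is_partition :: "nat list \<Rightarrow> bool" where
  "is_partition xs \<longleftrightarrow> sorted_wrt (\<ge>) xs \<and> (\<forall>x\<in>set xs. 0 < x)"

definition partition_of :: "nat \<Rightarrow> nat list \<Rightarrow> bool" where
  "partition_of n xs \<longleftrightarrow> is_partition xs \<and> sum_list xs = n"

definition subpartition :: "nat list \<Rightarrow> nat list \<Rightarrow> bool" where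
  "subpartition mu lam \<longleftrightarrow>
     is_partition mu \<and> length mu \<le> length lam \<and> (\<forall>i<length mu. mu ! i \<le> lam ! i)"

definition num_subpartitions :: "nat list \<Rightarrow> nat" where
  "num_subpartitions lam = card {mu. subpartition mu lam}"

definition maximizes_subpartitions :: "nat \<Rightarrow> nat list \<Rightarrow> bool" where
  "maximizes_subpartitions n lam \<longleftrightarrow>
     partition_of n lam \<and>
     (\<forall>mu. partition_of n mu \<longrightarrow> num_subpartitions mu \<le> num_subpartitions lam)"

text \<open>Rows and columns are counted from 0 here, so the box in row \<open>i\<close> and column \<open>j\<close> is
  \<open>[i, i + 1] \<times> [j, j + 1]\<close> before the rotation.\<close>

definition russian_box :: "nat \<Rightarrow> nat \<Rightarrow> (real \<times> real) set" where
  "russian_box i j =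
     {((s - t) / sqrt 2, (s + t) / sqrt 2) | s t.
        real i \<le> s \<and> s \<le> real i + 1 \<and> real j \<le> t \<and> t \<le> real j + 1}"

definition russian_diagram :: "nat list \<Rightarrow> (real \<times> real) set" where
  "russian_diagram lam =
     (\<Union>i<length lam. \<Union>j<lam ! i. russian_box i j) \<union> {(x, \<bar>x\<bar>) | x. True}"

text \<open>The maximum is over an infinite set, so \<open>Max\<close> is not applicable; it is attained, see
  \<open>boundary_greatest\<close> below.\<close>

definition boundary :: "nat list \<Rightarrow> real \<Rightarrow> real" where
  "boundary lam x = (GREATEST y. (x, y) \<in> russian_diagram lam)"

definition rescaled_boundary :: "nat list \<Rightarrow> real \<Rightarrow> real" where
  "rescaled_boundary lam x =
     boundary lam (sqrt (real (sum_list lam)) * x) / sqrt (real (sum_list lam))"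

lemma finite_subpartitions: "finite {mu. subpartition mu lam}"
proof (rule finite_subset)
  show "{mu. subpartition mu lam} \<subseteq> {xs. set xs \<subseteq> {..sum_list lam} \<and> length xs \<le> length lam}"
  proof (clarsimp simp: subpartition_def)
    fix mu x
    assume le: "length mu \<le> length lam" "\<forall>i<length mu. mu ! i \<le> lam ! i" and "x \<in> set mu"
    then obtain i where i: "i < length mu" "x = mu ! i"
      by (auto simp: in_set_conv_nth)
    with le have "x \<le> lam ! i" "lam ! i \<in> set lam" by auto
    then show "x \<le> sum_list lam" using member_le_sum_list by fastforce
  qed
  show "finite {xs. set xs \<subseteq> {..sum_list lam} \<and> length xs \<le> length lam}"
    by (rule finite_lists_length_le) simp
qed

lemma compact_russian_box: "compact (russian_box i j)"
proof -
  have "russian_box i j =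
      (\<lambda>p. ((fst p - snd p) / sqrt 2, (fst p + snd p) / sqrt 2)) `
        ({real i..real i + 1} \<times> {real j..real j + 1})"
    by (force simp: russian_box_def image_def)
  then show ?thesis
    by (auto intro!: compact_continuous_image continuous_intros compact_Times)
qed

lemma boundary_greatest:
  shows "(x, boundary lam x) \<in> russian_diagram lam"
    and "\<And>y. (x, y) \<in> russian_diagram lam \<Longrightarrow> y \<le> boundary lam x"
proof -
  define B where "B = (\<Union>i<length lam. \<Union>j<lam ! i. russian_box i j)"
  have B: "compact (insert (x, \<bar>x\<bar>) B)"
    unfolding B_def by (intro compact_insert compact_UN compact_russian_box) auto
  have "compact (insert (x, \<bar>x\<bar>) B \<inter> {p. fst p = x})"
    by (intro compact_Int_closed B closed_Collect_eq continuous_intros)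
  then have "compact (snd ` (insert (x, \<bar>x\<bar>) B \<inter> {p. fst p = x}))"
    by (intro compact_continuous_image continuous_intros)
  moreover have "snd ` (insert (x, \<bar>x\<bar>) B \<inter> {p. fst p = x}) = {y. (x, y) \<in> russian_diagram lam}"
    by (force simp: russian_diagram_def B_def)
  ultimately have "compact {y. (x, y) \<in> russian_diagram lam}" by simp
  moreover have "{y. (x, y) \<in> russian_diagram lam} \<noteq> {}" by (auto simp: russian_diagram_def)
  ultimately obtain m where m: "(x, m) \<in> russian_diagram lam"
      "\<And>y. (x, y) \<in> russian_diagram lam \<Longrightarrow> y \<le> m"
    using compact_attains_sup[of "{y. (x, y) \<in> russian_diagram lam}"] by blast
  then have "boundary lam x = m"
    unfolding boundary_def by (intro Greatest_equality)
  with m show "(x, boundary lam x) \<in> russian_diagram lam"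
    and "\<And>y. (x, y) \<in> russian_diagram lam \<Longrightarrow> y \<le> boundary lam x" by auto
qed

end

theory Submission
  imports Defs
begin

text \<open>
  Both claims come from one exponential count. Write \<open>a = pi / sqrt 6\<close>, so that
  \<open>pi * sqrt (2 * n / 3) = 2 * a * sqrt n\<close>.

  Upper bound. Give a partition \<open>\<mu>\<close> the weight \<open>x ^ |\<mu>|\<close> with \<open>x = exp (- a / sqrt n)\<close>. Euler's product for
  the total weight and \<open>\<Sum> 1 / k\<^sup>2 = pi\<^sup>2 / 6\<close> show that at most \<open>exp (2 * a * sqrt n)\<close> partitions have size at
  most \<open>n\<close>; all subpartitions of a partition of \<open>n\<close> are among them (\<open>num_subpartitions_le\<close>).

  Saving. If \<open>\<lambda>\<close> lacks the cell \<open>(i, j)\<close>, then every subpartition has at most \<open>i\<close> parts larger than \<open>j\<close>.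
  Under the weights above, the typical number of parts larger than \<open>\<tau> * sqrt n\<close> is
  \<open>- (sqrt n / a) * ln (1 - exp (- a * \<tau>))\<close>, which is the height at \<open>\<tau>\<close> of the curve
  \<open>exp (- a * \<sigma>) + exp (- a * \<tau>) = 1\<close>, rescaled. So a missing cell strictly below this curve makes the
  subpartitions atypical: a further factor \<open>z < 1\<close> for each part larger than \<open>j\<close> (Chernoff's method)
  improves the bound to \<open>exp ((2 * a - \<delta>) * sqrt n)\<close> (\<open>missing_cell_saving\<close>).

  Lower bound. A staircase with steps of width \<open>k\<close> contains, along its outer boundary, disjoint rectangles
  in which subpartitions can be chosen independently, each rectangle giving a binomial coefficient. Steps of
  width \<open>h * sqrt n\<close> whose heights follow the curve yield a Riemann sum that comes arbitrarily close to
  \<open>2 * a\<close> (\<open>ex_partition_many_subpartitions\<close>). This proves the asymptotic formula, and together with the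
  saving it shows that the maximizers eventually contain all cells that stay strictly below the curve.

  Shape. The region under the curve has area \<open>1\<close>, and the rescaled maximizers have area \<open>1\<close> too. As they fill
  that region up to an arbitrarily small area, they have no room for a point at a fixed distance above the
  curve, because it would bring a whole square of cells above the curve with it
  (\<open>rescaled_boundary_upper\<close>). In the rotated coordinates the curve is the graph of the limit function
  (\<open>limit_shape_curve\<close>).
\<close>

section \<open>Cells and subpartitions\<close>

definition cells :: "nat list \<Rightarrow> (nat \<times> nat) set" where
  "cells lam = (SIGMA i:{..<length lam}. {..<lam ! i})"

lemma finite_cells: "finite (cells lam)"
  by (simp add: cells_def)

lemma card_cells: "card (cells lam) = sum_list lam"
  by (simp add: cells_def sum_list_sum_nth atLeast0LessThan)

lemma is_partition_nth_mono:
  assumes "is_partition lam" "i \<le> j" "j < length lam"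
  shows "lam ! j \<le> lam ! i"
  using assms unfolding is_partition_def sorted_wrt_iff_nth_less
  by (cases "i = j") auto

lemma cells_down_closed:
  assumes "is_partition lam" "(i, j) \<in> cells lam" "i' \<le> i" "j' \<le> j"
  shows "(i', j') \<in> cells lam"
  using assms is_partition_nth_mono[of lam i' i] by (auto simp: cells_def)

lemma subpartition_trans:
  assumes "subpartition mu nu" "subpartition nu lam"
  shows "subpartition mu lam"
  using assms unfolding subpartition_def by (meson le_trans order_less_le_trans)

lemma num_subpartitions_mono:
  assumes "subpartition mu lam"
  shows "num_subpartitions mu \<le> num_subpartitions lam"
  unfolding num_subpartitions_def
  by (rule card_mono[OF finite_subpartitions]) (use assms subpartition_trans in blast)

lemma sum_list_subpartition_le:
  assumes "subpartition mu lam"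
  shows "sum_list mu \<le> sum_list lam"
proof -
  have "sum_list mu = (\<Sum>i<length mu. mu ! i)"
    by (simp add: sum_list_sum_nth atLeast0LessThan)
  also have "\<dots> \<le> (\<Sum>i<length mu. lam ! i)"
    using assms by (intro sum_mono) (auto simp: subpartition_def)
  also have "\<dots> \<le> (\<Sum>i<length lam. lam ! i)"
    using assms by (intro sum_mono2) (auto simp: subpartition_def)
  also have "\<dots> = sum_list lam"
    by (simp add: sum_list_sum_nth atLeast0LessThan)
  finally show ?thesis .
qed

text \<open>
  This turns geometry into the statistic to which the exponential weights apply: a cell outside \<open>\<lambda>\<close>
  restricts the number of large parts of all subpartitions at once.
\<close>
lemma few_large_parts_if_cell_missing:
  assumes "subpartition mu lam" "(i, j) \<notin> cells lam"
  shows "length (filter (\<lambda>p. j < p) mu) \<le> i"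
proof (cases "i < length mu")
  case True
  then have "lam ! i \<le> j" "mu ! i \<le> lam ! i"
    using assms by (auto simp: cells_def subpartition_def)
  moreover have "p \<le> mu ! i" if "p \<in> set (drop i mu)" for p
  proof -
    obtain k where k: "k < length (drop i mu)" "p = drop i mu ! k"
      using \<open>p \<in> set (drop i mu)\<close> by (metis in_set_conv_nth)
    have "mu ! (i + k) \<le> mu ! i"
      using assms(1) k(1) by (intro is_partition_nth_mono) (auto simp: subpartition_def)
    then show ?thesis using k True by simp
  qed
  ultimately have "\<forall>p\<in>set (drop i mu). \<not> j < p"
    by (meson le_trans not_less)
  then have "filter (\<lambda>p. j < p) (drop i mu) = []"
    by (auto simp: filter_empty_conv)
  then have "filter (\<lambda>p. j < p) mu = filter (\<lambda>p. j < p) (take i mu)"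
    by (metis append_Nil2 append_take_drop_id filter_append)
  then show ?thesis
    by (metis length_filter_le length_take min.bounded_iff min_def_raw order_trans)
next
  case False
  then show ?thesis
    by (meson length_filter_le le_trans linorder_not_less)
qed

lemma subpartitions_have_few_large_parts:
  assumes "partition_of n lam" "(i, j) \<notin> cells lam"
  shows "{mu. subpartition mu lam} \<subseteq>
    {mu. is_partition mu \<and> sum_list mu \<le> n \<and> length (filter (\<lambda>p. j < p) mu) \<le> i}"
proof safe
  fix mu assume mu: "subpartition mu lam"
  show "is_partition mu" using mu by (simp add: subpartition_def)
  show "sum_list mu \<le> n"
    using sum_list_subpartition_le[OF mu] assms(1) by (simp add: partition_of_def)
  show "length (filter (\<lambda>p. j < p) mu) \<le> i"
    by (rule few_large_parts_if_cell_missing[OF mu assms(2)])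
qed

lemma partition_eqI:
  assumes "is_partition mu" "is_partition nu" "mset mu = mset nu"
  shows "mu = nu"
proof -
  have "sorted (rev mu)" "sorted (rev nu)"
    using assms(1,2) by (simp_all add: is_partition_def sorted_wrt_rev)
  then have "rev mu = rev nu"
    using assms(3) by (metis mset_rev properties_for_sort)
  then show ?thesis by simp
qed

section \<open>Exponential upper bounds\<close>

text \<open>
  Chernoff's method for Euler's product. A partition is determined by its multiplicities \<open>c\<close>, and its weight
  \<open>x ^ |\<mu>| * z ^ #{parts > j}\<close> is the product of \<open>y p ^ c p\<close> over the part sizes \<open>p\<close>, where \<open>y p = x ^ p\<close>
  for \<open>p \<le> j\<close> and \<open>y p = x ^ p * z\<close> otherwise. Every partition that is counted has weight at least
  \<open>x ^ n * z ^ i\<close>, and the total weight of all multiplicity functions is a product of geometric series.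
\<close>
lemma card_partitions_few_large_parts_le:
  fixes x z :: real
  assumes x: "0 < x" "x < 1" and z: "0 < z" "z \<le> 1"
    and P: "P \<subseteq> {mu. is_partition mu \<and> sum_list mu \<le> n \<and> length (filter (\<lambda>p. j < p) mu) \<le> i}"
  shows "real (card P) * (x ^ n * z ^ i)
           \<le> (\<Prod>p\<in>{1..n}. inverse (1 - x ^ p * (if j < p then z else 1)))"
proof -
  define y where "y p = x ^ p * (if j < p then z else 1)" for p
  have y: "0 < y p" "y p \<le> x ^ p" for p
    using x z by (auto simp: y_def mult_left_le)
  have y1: "y p < 1" if "p \<in> {1..n}" for p
    using y(2)[of p] x that power_strict_decreasing[of 0 p x] by fastforce
  define m where "m mu = restrict (count (mset mu)) {1..n}" for mu :: "nat list"
  define W where "W c = (\<Prod>p\<in>{1..n}. y p ^ c p)" for c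
  have parts: "set mu \<subseteq> {1..n}" if "mu \<in> P" for mu
  proof
    fix p assume p: "p \<in> set mu"
    then have "p \<le> sum_list mu" by (rule member_le_sum_list) simp
    with p that P show "p \<in> {1..n}"
      by (fastforce simp: is_partition_def)
  qed
  have weight: "x ^ n * z ^ i \<le> W (m mu)" if mu: "mu \<in> P" for mu
  proof -
    have zero: "count (mset mu) p = 0" if "p \<notin> set mu" for p
      using that by (metis count_eq_zero_iff set_mset_mset)
    have "W (m mu) = (\<Prod>p\<in>{1..n}. y p ^ count (mset mu) p)"
      by (simp add: W_def m_def)
    also have "\<dots> = (\<Prod>p\<in>set_mset (mset mu). y p ^ count (mset mu) p)"
      using parts[OF mu]
      by (intro prod.mono_neutral_right) (auto simp: zero)
    also have "\<dots> = prod_list (map y mu)"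
      by (simp only: image_prod_mset_multiplicity[symmetric] mset_map[symmetric] prod_mset_prod_list)
    also have "\<dots> = x ^ sum_list mu * z ^ length (filter (\<lambda>p. j < p) mu)"
      by (induction mu) (auto simp: y_def power_add)
    also have "\<dots> \<ge> x ^ n * z ^ i"
      using mu P x z by (intro mult_mono power_decreasing) auto
    finally show ?thesis .
  qed
  have inj: "inj_on m P"
  proof (rule inj_onI)
    fix mu nu assume *: "mu \<in> P" "nu \<in> P" "m mu = m nu"
    have "count (mset mu) p = count (mset nu) p" for p
    proof (cases "p \<in> {1..n}")
      case True
      then show ?thesis using *(3) by (metis m_def restrict_apply')
    next
      case False
      then show ?thesis using parts[OF *(1)] parts[OF *(2)]
        by (metis count_eq_zero_iff set_mset_mset subsetD)
    qed
    then have "mset mu = mset nu" by (rule multiset_eqI)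
    then show "mu = nu" using * P by (intro partition_eqI) auto
  qed
  have range: "m ` P \<subseteq> PiE {1..n} (\<lambda>_. {..n})"
  proof
    fix c assume "c \<in> m ` P"
    then obtain mu where mu: "mu \<in> P" "c = m mu" by auto
    have "count (mset mu) p \<le> n" for p
    proof -
      have "count (mset mu) p \<le> length mu" by (metis count_le_length count_mset)
      also have "length mu \<le> sum_list mu"
        using parts[OF mu(1)] by (induction mu) auto
      finally show ?thesis using mu P by auto
    qed
    then show "c \<in> PiE {1..n} (\<lambda>_. {..n})" using mu by (auto simp: m_def)
  qed
  have fin: "finite P"
    using range inj by (meson finite_PiE finite_atLeastAtMost finite_atMost finite_imageD finite_subset)
  have "real (card P) * (x ^ n * z ^ i) = (\<Sum>mu\<in>P. x ^ n * z ^ i)" by simp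
  also have "\<dots> \<le> (\<Sum>mu\<in>P. W (m mu))" by (intro sum_mono weight)
  also have "\<dots> = (\<Sum>c\<in>m ` P. W c)" using inj by (simp add: sum.reindex)
  also have "\<dots> \<le> (\<Sum>c\<in>PiE {1..n} (\<lambda>_. {..n}). W c)"
    using range y(1) by (intro sum_mono2 finite_PiE) (auto simp: W_def intro!: less_imp_le prod_pos)
  also have "\<dots> = (\<Prod>p\<in>{1..n}. \<Sum>c\<le>n. y p ^ c)"
    unfolding W_def by (rule prod_sum_PiE[symmetric]) auto
  also have "\<dots> \<le> (\<Prod>p\<in>{1..n}. inverse (1 - y p))"
  proof (intro prod_mono conjI)
    fix p assume p: "p \<in> {1..n}"
    show "0 \<le> (\<Sum>c\<le>n. y p ^ c)" using y(1)[of p] by (intro sum_nonneg) (simp add: less_imp_le)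
    have "(\<Sum>c\<le>n. y p ^ c) = (1 - y p ^ Suc n) / (1 - y p)"
      using y1[OF p] by (subst sum_gp0) auto
    also have "\<dots> \<le> inverse (1 - y p)"
      using y1[OF p] y(1)[of p] by (simp add: inverse_eq_divide divide_right_mono less_imp_le)
    finally show "(\<Sum>c\<le>n. y p ^ c) \<le> inverse (1 - y p)" .
  qed
  finally show ?thesis by (simp add: y_def)
qed

text \<open>The logarithm of the Euler factor of a part of weight \<open>exp (- u)\<close>.\<close>
definition free_energy :: "real \<Rightarrow> real" where "free_energy u = - ln (1 - exp (- u))"

lemma free_energy_sums:
  assumes "0 < u"
  shows "(\<lambda>m. exp (- u * (real m + 1)) / (real m + 1)) sums free_energy u"
proof -
  have "(\<lambda>m. - ((- (- exp (- u))) ^ m) / real m) sums ln (1 + - exp (- u))"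
    by (rule ln_series') (use assms in simp)
  then have "(\<lambda>m. exp (- u) ^ m / real m) sums free_energy u"
    unfolding free_energy_def using sums_minus by fastforce
  then have "(\<lambda>m. exp (- u) ^ Suc m / real (Suc m)) sums free_energy u"
    by (subst sums_Suc_iff) simp
  then show ?thesis
    by (simp add: exp_of_nat_mult[symmetric] algebra_simps flip: exp_add)
qed

lemma sum_exp_multiples_le:
  fixes t :: real
  assumes "0 < t"
  shows "(\<Sum>p\<in>{1..n}. exp (- t * real p)) \<le> 1 / t"
proof -
  have x: "0 < exp (- t)" "exp (- t) < 1" using assms by auto
  have "(\<Sum>p\<in>{1..n}. exp (- t * real p)) = (\<Sum>p\<in>{1..n}. exp (- t) ^ p)"
    by (simp add: exp_of_nat_mult[symmetric] mult.commute)
  also have "\<dots> = exp (- t) * (1 - exp (- t) ^ n) / (1 - exp (- t))"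
    using x by (simp add: sum_gp_multiplied sum_gp field_simps)
  also have "\<dots> \<le> exp (- t) / (1 - exp (- t))"
    using x by (intro divide_right_mono) (auto simp: mult_left_le)
  also have "\<dots> = 1 / (exp t - 1)"
    using assms by (simp add: field_simps exp_minus)
  also have "\<dots> \<le> 1 / t"
    using assms exp_ge_add_one_self[of t]
    by (intro divide_left_mono) (auto simp: algebra_simps simp del: exp_ge_add_one_self)
  finally show ?thesis .
qed

text \<open>
  Expanding each logarithm and summing over \<open>p\<close> first bounds the \<open>m\<close>-th terms together by
  \<open>1 / (t * m\<^sup>2)\<close>, so that \<open>\<Sum> 1 / m\<^sup>2 = pi\<^sup>2 / 6\<close> appears.
\<close>
lemma sum_free_energy_le:
  assumes t: "0 < t"
  shows "(\<Sum>p\<in>{1..n}. free_energy (t * real p)) \<le> pi\<^sup>2 / (6 * t)"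
proof (rule sums_le)
  show "(\<lambda>m. \<Sum>p\<in>{1..n}. exp (- (t * real p) * (real m + 1)) / (real m + 1))
          sums (\<Sum>p\<in>{1..n}. free_energy (t * real p))"
    using t by (intro sums_sum free_energy_sums) auto
  show "(\<lambda>m. (1 / t) * (1 / (real m + 1)\<^sup>2)) sums (pi\<^sup>2 / (6 * t))"
    using sums_mult[OF inverse_squares_sums, of "1 / t"] t by (simp add: mult.commute add.commute)
  show "(\<Sum>p\<in>{1..n}. exp (- (t * real p) * (real m + 1)) / (real m + 1))
          \<le> (1 / t) * (1 / (real m + 1)\<^sup>2)" for m
  proof -
    have "(\<Sum>p\<in>{1..n}. exp (- (t * real p) * (real m + 1)) / (real m + 1))
        = (\<Sum>p\<in>{1..n}. exp (- (t * (real m + 1)) * real p)) / (real m + 1)"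
      by (simp add: sum_divide_distrib mult_ac)
    also have "\<dots> \<le> (1 / (t * (real m + 1))) / (real m + 1)"
      using t by (intro divide_right_mono sum_exp_multiples_le) auto
    finally show ?thesis by (simp add: power2_eq_square mult.assoc)
  qed
qed

text \<open>
  The preceding bound is sharp for small \<open>t\<close>: the integral of \<open>free_energy\<close> over the positive reals is \<open>pi\<^sup>2 / 6\<close>.
  It suffices to keep finitely many terms of the expansion, to let \<open>v\<close> tend to \<open>0\<close> in the sum over all
  \<open>b\<close>, which is geometric for each term, and to truncate that sum last.
\<close>
lemma free_energy_riemann_sum:
  assumes "0 < \<epsilon>"
  shows "\<exists>v>0. \<exists>B\<ge>1. pi\<^sup>2 / 6 - \<epsilon> < v * (\<Sum>b\<in>{1..B}. free_energy (v * real b))"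
proof -
  have "(\<lambda>J. \<Sum>m<J. 1 / (real m + 1)\<^sup>2) \<longlonglongrightarrow> pi\<^sup>2 / 6"
    using inverse_squares_sums by (simp add: sums_def add.commute)
  then have "\<forall>\<^sub>F J in sequentially. pi\<^sup>2 / 6 - \<epsilon> < (\<Sum>m<J. 1 / (real m + 1)\<^sup>2)"
    using assms by (intro order_tendstoD) auto
  then obtain J where J: "pi\<^sup>2 / 6 - \<epsilon> < (\<Sum>m<J. 1 / (real m + 1)\<^sup>2)"
    using eventually_happens by force
  \<comment> \<open>\<open>G v m\<close> is the contribution of the \<open>m\<close>-th term of the expansion, summed over all \<open>b \<ge> 1\<close>;
    \<open>H B m\<close> below is its truncation to \<open>b \<le> B\<close>.\<close>
  define G where "G v m = v / (real m + 1) / (exp (v * (real m + 1)) - 1)" for v :: real and m :: nat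
  have "((\<lambda>v. \<Sum>m<J. G v m) \<longlongrightarrow> (\<Sum>m<J. 1 / (real m + 1)\<^sup>2)) (at_right 0)"
  proof (intro tendsto_sum)
    fix m :: nat
    define c where "c = real m + 1"
    have c: "c > 0" by (simp add: c_def)
    have "((\<lambda>v. (exp (c * v) - 1) / v) \<longlongrightarrow> c) (at 0)"
    proof -
      have "((\<lambda>v. exp (c * v)) has_real_derivative c) (at 0)"
        by (auto intro!: derivative_eq_intros)
      then show ?thesis by (simp add: has_field_derivative_iff)
    qed
    then have "((\<lambda>v. (exp (c * v) - 1) / v) \<longlongrightarrow> c) (at_right 0)"
      by (rule filterlim_mono[OF _ order_refl]) (auto simp: at_le)
    then have "((\<lambda>v. (1 / c) / ((exp (c * v) - 1) / v)) \<longlongrightarrow> (1 / c) / c) (at_right 0)"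
      using c by (intro tendsto_divide tendsto_const) auto
    then show "((\<lambda>v. G v m) \<longlongrightarrow> 1 / (real m + 1)\<^sup>2) (at_right 0)"
      by (simp add: G_def c_def power2_eq_square mult_ac)
  qed
  from order_tendstoD(1)[OF this J]
  have "\<forall>\<^sub>F v in at_right 0. pi\<^sup>2 / 6 - \<epsilon> < (\<Sum>m<J. G v m) \<and> 0 < v"
    by (simp add: eventually_conj_iff eventually_at_right_less)
  then obtain v where v: "pi\<^sup>2 / 6 - \<epsilon> < (\<Sum>m<J. G v m)" "0 < v"
    using eventually_happens[of _ "at_right (0::real)"] by force
  define H where "H B m = v / (real m + 1) * (\<Sum>b\<in>{1..B}. exp (- (v * (real m + 1)) * real b))" for B m
  have "(\<lambda>B. \<Sum>m<J. H B m) \<longlonglongrightarrow> (\<Sum>m<J. G v m)"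
  proof (intro tendsto_sum)
    fix m :: nat
    define w where "w = v * (real m + 1)"
    have w: "w > 0" using v by (simp add: w_def)
    have "(\<lambda>b. exp (- w) * exp (- w) ^ b) sums (exp (- w) * (1 / (1 - exp (- w))))"
      using w by (intro sums_mult geometric_sums) auto
    then have "(\<lambda>B. \<Sum>b<B. exp (- w) ^ Suc b) \<longlonglongrightarrow> exp (- w) / (1 - exp (- w))"
      by (simp add: sums_def)
    also have "exp (- w) / (1 - exp (- w)) = 1 / (exp w - 1)"
      using w by (simp add: field_simps exp_minus)
    also have "(\<lambda>B. \<Sum>b<B. exp (- w) ^ Suc b) = (\<lambda>B. \<Sum>b\<in>{1..B}. exp (- w * real b))"
      by (simp add: sum.atLeast1_atMost_eq exp_of_nat_mult[symmetric] algebra_simps flip: exp_add)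
    finally have "(\<lambda>B. v / (real m + 1) * (\<Sum>b\<in>{1..B}. exp (- w * real b)))
        \<longlonglongrightarrow> v / (real m + 1) * (1 / (exp w - 1))"
      by (intro tendsto_intros)
    then show "(\<lambda>B. H B m) \<longlonglongrightarrow> G v m"
      by (simp add: H_def G_def w_def)
  qed
  from order_tendstoD(1)[OF this v(1)]
  have "\<forall>\<^sub>F B in sequentially. pi\<^sup>2 / 6 - \<epsilon> < (\<Sum>m<J. H B m) \<and> 1 \<le> B"
    by (simp add: eventually_conj_iff eventually_ge_at_top)
  then obtain B where B: "pi\<^sup>2 / 6 - \<epsilon> < (\<Sum>m<J. H B m)" "1 \<le> B"
    using eventually_happens by force
  have "(\<Sum>m<J. H B m) = v * (\<Sum>b\<in>{1..B}. \<Sum>m<J. exp (- (v * real b) * (real m + 1)) / (real m + 1))"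
    unfolding H_def by (subst sum.swap) (simp add: sum_distrib_left mult_ac)
  also have "\<dots> \<le> v * (\<Sum>b\<in>{1..B}. free_energy (v * real b))"
  proof (intro mult_left_mono sum_mono)
    fix b assume "b \<in> {1..B}"
    then have "0 < v * real b" using v by simp
    note S = free_energy_sums[OF this]
    have "(\<Sum>m<J. exp (- (v * real b) * (real m + 1)) / (real m + 1))
            \<le> (\<Sum>m. exp (- (v * real b) * (real m + 1)) / (real m + 1))"
      by (intro sum_le_suminf sums_summable[OF S]) auto
    then show "(\<Sum>m<J. exp (- (v * real b) * (real m + 1)) / (real m + 1)) \<le> free_energy (v * real b)"
      by (simp only: sums_unique[OF S, symmetric])
  qed (use v in simp)
  finally show ?thesis using B v by (intro exI[of _ v] exI[of _ B]) auto
qed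

lemma exp_free_energy:
  assumes "0 < u"
  shows "exp (free_energy u) = inverse (1 - exp (- u))"
proof -
  have "0 < 1 - exp (- u)" using assms by simp
  then show ?thesis unfolding free_energy_def exp_minus[of "ln _"] by simp
qed

text \<open>
  The logarithmic form of the Chernoff bound for \<open>x = exp (- t)\<close>. The factor \<open>z\<close> lowers the logarithm of
  the Euler factor of \<open>p > j\<close> by at least \<open>(1 - z) * y / (1 - z * y)\<close> with \<open>y = exp (- t * p)\<close>, and this is
  at least a constant multiple of \<open>T (p + 1) - T p\<close>, where \<open>T\<close> is an antiderivative of it in \<open>p\<close> up to that
  constant; so the sum over \<open>p\<close> telescopes.
\<close>
lemma card_partitions_few_large_parts_exp_le:
  fixes t z :: real
  assumes t: "0 < t" and z: "0 < z" "z < 1" and jn: "j \<le> n"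
    and P: "P \<subseteq> {mu. is_partition mu \<and> sum_list mu \<le> n \<and> length (filter (\<lambda>p. j < p) mu) \<le> i}"
  shows "real (card P) \<le> exp (real n * t + pi\<^sup>2 / (6 * t) + (1 - z) / z *
           (real i + (ln (1 - z * exp (- t * (real j + 1))) - ln (1 - z * exp (- t * (real n + 1)))) / t))"
proof -
  define x where "x = exp (- t)"
  define T where "T p = ln (1 - z * exp (- t * real p))" for p
  have x: "0 < x" "x < 1" using t by (auto simp: x_def)
  have xp: "x ^ p = exp (- t * real p)" for p
    by (simp add: x_def exp_of_nat_mult[symmetric] mult.commute)
  have factor: "inverse (1 - x ^ p * (if j < p then z else 1))
      \<le> exp (free_energy (t * real p) - (1 - z) / (z * t) * (if j < p then T (Suc p) - T p else 0))"
    if p: "p \<in> {1..n}" for p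
  proof -
    define y where "y = exp (- t * real p)"
    have y: "0 < y" "y < 1" using p t by (auto simp: y_def)
    have zy: "0 < z * y" "z * y < 1" using z y mult_strict_mono[of z 1 y 1] by auto
    show ?thesis
    proof (cases "j < p")
      case False
      then show ?thesis
        using p t by (simp add: xp exp_free_energy)
    next
      case True
      \<comment> \<open>Both estimates use \<open>ln x - ln y \<le> (x - y) / y\<close> with the denominator \<open>1 - z * y\<close>, in opposite directions.\<close>
      have "T (Suc p) - T p \<le> ((1 - z * exp (- t * real (Suc p))) - (1 - z * y)) / (1 - z * y)"
      proof -
        have "exp (- t * real (Suc p)) \<le> y" using t by (simp add: y_def algebra_simps)
        then have "z * exp (- t * real (Suc p)) \<le> z * y" using z by simp
        then show ?thesis unfolding T_def y_def[symmetric]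
          using zy y by (intro ln_diff_le) auto
      qed
      also have "(1 - z * exp (- t * real (Suc p))) - (1 - z * y) = z * y * (1 - exp (- t))"
        by (simp add: y_def algebra_simps flip: exp_add)
      also have "\<dots> / (1 - z * y) \<le> z * y * t / (1 - z * y)"
        using zy y exp_ge_add_one_self[of "- t"] by (intro divide_right_mono mult_left_mono) auto
      finally have "(1 - z) / (z * t) * (T (Suc p) - T p) \<le> (1 - z) / (z * t) * (z * y * t / (1 - z * y))"
        using z t by (intro mult_left_mono) auto
      also have "\<dots> = - (((1 - y) - (1 - z * y)) / (1 - z * y))"
        using z t zy y by (simp add: field_simps)
      also have "\<dots> \<le> - (ln (1 - y) - ln (1 - z * y))"
        using zy y by (intro le_imp_neg_le ln_diff_le) auto
      also have "\<dots> = free_energy (t * real p) + ln (1 - z * y)"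
        by (simp add: free_energy_def y_def)
      finally have "- ln (1 - z * y) \<le> free_energy (t * real p) - (1 - z) / (z * t) * (T (Suc p) - T p)"
        by simp
      moreover have "inverse (1 - x ^ p * z) = exp (- ln (1 - z * y))"
        using zy unfolding xp y_def[symmetric] exp_minus[of "ln _"] by (simp add: mult.commute)
      ultimately show ?thesis using True by simp
    qed
  qed
  have "real (card P) * (x ^ n * z ^ i) \<le> (\<Prod>p\<in>{1..n}. inverse (1 - x ^ p * (if j < p then z else 1)))"
    using x z P by (intro card_partitions_few_large_parts_le) auto
  also have "\<dots> \<le> (\<Prod>p\<in>{1..n}. exp (free_energy (t * real p) - (1 - z) / (z * t) * (if j < p then T (Suc p) - T p else 0)))"
  proof (intro prod_mono conjI factor)
    fix p assume "p \<in> {1..n}"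
    then have "x ^ p \<le> 1" using x by (simp add: power_le_one)
    then have "x ^ p * (if j < p then z else 1) \<le> 1"
      using x z by (auto intro: mult_le_one)
    then show "0 \<le> inverse (1 - x ^ p * (if j < p then z else 1))" by simp
  qed auto
  also have "\<dots> = exp ((\<Sum>p\<in>{1..n}. free_energy (t * real p))
                 - (1 - z) / (z * t) * (\<Sum>p\<in>{1..n}. if j < p then T (Suc p) - T p else 0))"
    by (simp add: exp_sum[symmetric] sum_subtractf sum_distrib_left)
  also have "(\<Sum>p\<in>{1..n}. if j < p then T (Suc p) - T p else 0) = (\<Sum>p=Suc j..n. T (Suc p) - T p)"
    by (rule sum.mono_neutral_cong_right) auto
  also have "\<dots> = T (Suc n) - T (Suc j)"
    using jn by (intro sum_Suc_diff) auto
  finally have "real (card P) * (x ^ n * z ^ i)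
      \<le> exp ((\<Sum>p\<in>{1..n}. free_energy (t * real p)) - (1 - z) / (z * t) * (T (Suc n) - T (Suc j)))" .
  also have "\<dots> \<le> exp (pi\<^sup>2 / (6 * t) - (1 - z) / (z * t) * (T (Suc n) - T (Suc j)))"
    using sum_free_energy_le[OF t] by simp
  finally have "real (card P) \<le> exp (pi\<^sup>2 / (6 * t) - (1 - z) / (z * t) * (T (Suc n) - T (Suc j))) / (x ^ n * z ^ i)"
    using x z by (simp add: pos_le_divide_eq)
  also have "x ^ n * z ^ i = exp (- (real n * t + real i * (- ln z)))"
    using z by (simp add: xp exp_diff exp_of_nat_mult mult.commute exp_minus field_simps)
  also have "exp (pi\<^sup>2 / (6 * t) - (1 - z) / (z * t) * (T (Suc n) - T (Suc j))) / \<dots>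
      = exp (pi\<^sup>2 / (6 * t) - (1 - z) / (z * t) * (T (Suc n) - T (Suc j)) + (real n * t + real i * (- ln z)))"
    by (simp only: exp_diff[symmetric] diff_minus_eq_add)
  also have "\<dots> \<le> exp (pi\<^sup>2 / (6 * t) - (1 - z) / (z * t) * (T (Suc n) - T (Suc j)) + (real n * t + real i * ((1 - z) / z)))"
  proof -
    have "- ln z \<le> (1 - z) / z"
      using ln_diff_le[of 1 z] z by simp
    then have "real i * (- ln z) \<le> real i * ((1 - z) / z)" by (rule mult_left_mono) simp
    then show ?thesis by simp
  qed
  also have "\<dots> = exp (real n * t + pi\<^sup>2 / (6 * t) + (1 - z) / z *
           (real i + (T (Suc j) - T (Suc n)) / t))"
    using z t by (simp add: field_simps)
  finally show ?thesis by (simp add: T_def add.commute)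
qed

text \<open>
  The rate that is optimal for partitions of \<open>n\<close>: \<open>t = decay / sqrt n\<close> minimizes the exponent
  \<open>n * t + pi\<^sup>2 / (6 * t)\<close>. The minimum \<open>2 * decay * sqrt n\<close> is the exponent of the theorem.
\<close>
definition decay :: real where "decay = pi / sqrt 6"

lemma decay_pos: "0 < decay" by (simp add: decay_def)

lemma decay_sq: "decay\<^sup>2 = pi\<^sup>2 / 6" by (simp add: decay_def power_divide)

lemma tilt_cost:
  assumes "0 < n"
  shows "real n * (decay / sqrt (real n)) + pi\<^sup>2 / (6 * (decay / sqrt (real n))) = 2 * decay * sqrt (real n)"
proof -
  have "pi\<^sup>2 = 6 * decay\<^sup>2" by (simp add: decay_sq)
  then show ?thesis using assms decay_pos
    by (simp add: field_simps power2_eq_square)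
qed

text \<open>
  All subpartitions have size at most \<open>n\<close>, and the Chernoff bound with \<open>z = 1\<close> counts the partitions of size
  at most \<open>n\<close>; a cell in row \<open>length lam\<close> is missing, which makes that bound applicable.
\<close>
lemma num_subpartitions_le:
  assumes lam: "partition_of n lam" and n: "0 < n"
  shows "real (num_subpartitions lam) \<le> exp (2 * decay * sqrt (real n))"
proof -
  define t where "t = decay / sqrt (real n)"
  have t: "0 < t" using n decay_pos by (simp add: t_def)
  have xp: "exp (- t) ^ p = exp (- (t * real p))" for p
    by (simp add: exp_of_nat_mult[symmetric] mult.commute)
  let ?P = "{mu. subpartition mu lam}"
  have "real (card ?P) * (exp (- t) ^ n * 1 ^ length lam)
          \<le> (\<Prod>p\<in>{1..n}. inverse (1 - exp (- t) ^ p * (if 0 < p then 1 else 1)))"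
  proof (rule card_partitions_few_large_parts_le)
    show "?P \<subseteq> {mu. is_partition mu \<and> sum_list mu \<le> n \<and> length (filter (\<lambda>p. 0 < p) mu) \<le> length lam}"
      by (rule subpartitions_have_few_large_parts[OF lam]) (simp add: cells_def)
  qed (use t in auto)
  also have "\<dots> = (\<Prod>p\<in>{1..n}. exp (free_energy (t * real p)))"
    using t by (intro prod.cong) (auto simp: exp_free_energy xp)
  also have "\<dots> = exp (\<Sum>p\<in>{1..n}. free_energy (t * real p))" by (simp add: exp_sum)
  also have "\<dots> \<le> exp (pi\<^sup>2 / (6 * t))" using sum_free_energy_le[OF t] by simp
  finally have "real (card ?P) \<le> exp (pi\<^sup>2 / (6 * t)) / exp (- (t * real n))"
    by (simp add: xp pos_le_divide_eq)
  also have "\<dots> = exp (real n * t + pi\<^sup>2 / (6 * t))"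
    by (simp add: exp_diff[symmetric] algebra_simps)
  also have "real n * t + pi\<^sup>2 / (6 * t) = 2 * decay * sqrt (real n)"
    unfolding t_def by (rule tilt_cost[OF n])
  finally show ?thesis by (simp add: num_subpartitions_def)
qed

lemma sqrt_of_nat_at_top: "filterlim (\<lambda>n. sqrt (real n)) at_top sequentially"
  by (rule filterlim_compose[OF sqrt_at_top filterlim_real_sequentially])

text \<open>
  At \<open>z = 1\<close> the exponent of the Chernoff bound is \<open>2 * decay * sqrt n\<close>, and strictly below the curve its
  derivative in \<open>z\<close> is positive, so that a slightly smaller \<open>z\<close> gains a positive multiple of \<open>sqrt n\<close>.
  Explicitly, the gain is governed by \<open>D\<close>, which is positive once \<open>z * exp (- decay * \<tau>)\<close> exceeds
  \<open>1 - exp (- decay * \<sigma>)\<close>; being below the curve leaves room for such a \<open>z < 1\<close>.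
\<close>
lemma missing_cell_saving:
  fixes \<sigma> \<tau> :: real
  assumes \<tau>: "0 < \<tau>" and below: "1 < exp (- decay * \<sigma>) + exp (- decay * \<tau>)"
  shows "\<exists>\<delta>>0. \<forall>\<^sub>F n in sequentially. \<forall>i j lam.
           partition_of n lam \<and> (i, j) \<notin> cells lam \<and>
           real i \<le> \<sigma> * sqrt (real n) \<and> real j + 1 \<le> \<tau> * sqrt (real n) \<longrightarrow>
           real (num_subpartitions lam) \<le> exp ((2 * decay - \<delta>) * sqrt (real n))"
proof -
  have "(1 - exp (- decay * \<sigma>)) * exp (decay * \<tau>) < exp (- decay * \<tau>) * exp (decay * \<tau>)"
    using below by (intro mult_strict_right_mono) auto
  then have "max 0 ((1 - exp (- decay * \<sigma>)) * exp (decay * \<tau>)) < 1"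
    by (simp add: exp_minus)
  then obtain z where z: "max 0 ((1 - exp (- decay * \<sigma>)) * exp (decay * \<tau>)) < z" "z < 1"
    using dense by blast
  then have z0: "0 < z" by simp
  have "(1 - exp (- decay * \<sigma>)) * exp (decay * \<tau>) * exp (- decay * \<tau>) < z * exp (- decay * \<tau>)"
    using z by (intro mult_strict_right_mono) auto
  then have "1 - z * exp (- decay * \<tau>) < exp (- decay * \<sigma>)"
    by (simp add: mult.assoc flip: exp_add)
  moreover have pos: "0 < 1 - z * exp (- decay * \<tau>)"
  proof -
    have "z * exp (- decay * \<tau>) < 1 * 1"
      using z z0 \<tau> decay_pos by (intro mult_strict_mono) auto
    then show ?thesis by simp
  qed
  ultimately have "ln (1 - z * exp (- decay * \<tau>)) < - decay * \<sigma>"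
    by (metis exp_less_cancel_iff exp_ln)
  define D where "D = - (\<sigma> + ln (1 - z * exp (- decay * \<tau>)) / decay)"
  have D: "0 < D"
    using \<open>ln _ < _\<close> decay_pos by (simp add: D_def field_simps)
  define \<delta> where "\<delta> = (1 - z) / z * (D / 2)"
  have "\<delta> > 0" using z z0 D by (simp add: \<delta>_def)
  \<comment> \<open>Only parts up to \<open>n\<close> occur; cutting the sum there costs half of the gain at most.\<close>
  have "(\<lambda>n. exp (- (decay * sqrt (real n)))) \<longlonglongrightarrow> 0"
    by (intro filterlim_compose[OF exp_at_bot] filterlim_compose[OF filterlim_uminus_at_bot_at_top]
        filterlim_tendsto_pos_mult_at_top[OF tendsto_const decay_pos] sqrt_of_nat_at_top)
  then have "(\<lambda>n. - ln (1 - exp (- (decay * sqrt (real n))))) \<longlonglongrightarrow> - ln (1 - 0)"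
    by (intro tendsto_intros) auto
  then have "\<forall>\<^sub>F n in sequentially. - ln (1 - exp (- (decay * sqrt (real n)))) < decay * (D / 2)"
    using D decay_pos by (intro order_tendstoD) auto
  moreover have "\<forall>\<^sub>F n in sequentially. max 1 \<tau> \<le> sqrt (real n)"
    using sqrt_of_nat_at_top unfolding filterlim_at_top by blast
  ultimately have "\<forall>\<^sub>F n in sequentially. \<forall>i j lam.
           partition_of n lam \<and> (i, j) \<notin> cells lam \<and>
           real i \<le> \<sigma> * sqrt (real n) \<and> real j + 1 \<le> \<tau> * sqrt (real n) \<longrightarrow>
           real (num_subpartitions lam) \<le> exp ((2 * decay - \<delta>) * sqrt (real n))"
  proof (eventually_elim, safe)
    fix n i j lam
    assume small: "- ln (1 - exp (- (decay * sqrt (real n)))) < decay * (D / 2)"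
      and large: "max 1 \<tau> \<le> sqrt (real n)"
      and lam: "partition_of n lam" "(i, j) \<notin> cells lam"
      and ij: "real i \<le> \<sigma> * sqrt (real n)" "real j + 1 \<le> \<tau> * sqrt (real n)"
    define s where "s = sqrt (real n)"
    have s: "s \<ge> 1" "s * s = real n" "\<tau> \<le> s" using large by (auto simp: s_def)
    then have n: "0 < n" by (cases n) auto
    define t where "t = decay / s"
    have t: "0 < t" using s decay_pos by (simp add: t_def)
    have "real j + 1 \<le> real n"
      using ij(2) mult_right_mono[OF s(3), of s] s by (simp flip: s_def)
    then have jn: "j \<le> n" by simp
    have *: "real (num_subpartitions lam) \<le> exp (real n * t + pi\<^sup>2 / (6 * t) + (1 - z) / z *
           (real i + (ln (1 - z * exp (- t * (real j + 1))) - ln (1 - z * exp (- t * (real n + 1)))) / t))"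
      unfolding num_subpartitions_def
      by (rule card_partitions_few_large_parts_exp_le[OF t z0 z(2) jn
            subpartitions_have_few_large_parts[OF lam]])
    have head: "ln (1 - z * exp (- t * (real j + 1))) \<le> ln (1 - z * exp (- decay * \<tau>))"
    proof -
      have "t * (real j + 1) \<le> t * (\<tau> * s)"
        using ij(2) t by (intro mult_left_mono) (auto simp: s_def)
      also have "\<dots> = decay * \<tau>" using s by (simp add: t_def)
      finally have "exp (- decay * \<tau>) \<le> exp (- t * (real j + 1))" by simp
      moreover have "z * exp (- t * (real j + 1)) < 1 * 1"
        using z z0 t by (intro mult_strict_mono) auto
      ultimately show ?thesis using z0 pos by simp
    qed
    have tail: "- ln (1 - z * exp (- t * (real n + 1))) \<le> decay * (D / 2)"
    proof -
      have "decay * s \<le> t * (real n + 1)"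
        using s decay_pos by (simp add: t_def field_simps)
      then have "exp (- t * (real n + 1)) \<le> exp (- (decay * s))" by simp
      then have "z * exp (- t * (real n + 1)) \<le> 1 * exp (- (decay * s))"
        using z z0 by (intro mult_mono) auto
      moreover have "exp (- (decay * s)) < 1" using s decay_pos by simp
      ultimately have "ln (1 - exp (- (decay * s))) \<le> ln (1 - z * exp (- t * (real n + 1)))"
        by (subst ln_le_cancel_iff) linarith+
      then show ?thesis using small by (simp add: s_def)
    qed
    have "real i + (ln (1 - z * exp (- t * (real j + 1))) - ln (1 - z * exp (- t * (real n + 1)))) / t
        \<le> \<sigma> * s + (ln (1 - z * exp (- decay * \<tau>)) + decay * (D / 2)) / t"
      using ij(1) head tail t by (intro add_mono divide_right_mono) (auto simp: s_def)
    also have "\<dots> = - (D / 2) * s"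
      using s decay_pos by (simp add: t_def D_def field_simps)
    finally have "(1 - z) / z *
       (real i + (ln (1 - z * exp (- t * (real j + 1))) - ln (1 - z * exp (- t * (real n + 1)))) / t)
        \<le> (1 - z) / z * (- (D / 2) * s)"
      using z z0 by (intro mult_left_mono) auto
    then have "real n * t + pi\<^sup>2 / (6 * t) + (1 - z) / z *
       (real i + (ln (1 - z * exp (- t * (real j + 1))) - ln (1 - z * exp (- t * (real n + 1)))) / t)
        \<le> (2 * decay - \<delta>) * s"
      using tilt_cost[OF n] by (simp add: t_def s_def \<delta>_def algebra_simps)
    with * show "real (num_subpartitions lam) \<le> exp ((2 * decay - \<delta>) * sqrt (real n))"
      unfolding s_def using exp_le_cancel_iff order_trans by blast
  qed
  with \<open>\<delta> > 0\<close> show ?thesis by blast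
qed

section \<open>A partition with many subpartitions\<close>

text \<open>
  Moving \<open>lam\<close> by \<open>k\<close> columns to the right and placing \<open>lam'\<close> below lets a subpartition of each be chosen
  independently: they are moved and joined in the same way. The join can be undone, because all parts of the
  upper portion exceed \<open>k\<close> and none of the lower portion does.
\<close>
lemma num_subpartitions_stack:
  assumes lam': "\<forall>x\<in>set lam'. x \<le> k"
  shows "num_subpartitions lam * num_subpartitions lam'
           \<le> num_subpartitions (map (\<lambda>x. x + k) lam @ lam')"
proof -
  let ?join = "\<lambda>(mu, nu). map (\<lambda>x. x + k) mu @ nu"
  let ?S = "{mu. subpartition mu lam} \<times> {nu. subpartition nu lam'}"
  have small: "\<forall>x\<in>set nu. x \<le> k" if "subpartition nu lam'" for nu
  proof
    fix x assume "x \<in> set nu"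
    then obtain i where "i < length nu" "x = nu ! i" by (metis in_set_conv_nth)
    with that have "x \<le> lam' ! i" "i < length lam'" by (auto simp: subpartition_def)
    then show "x \<le> k" using lam' nth_mem le_trans by blast
  qed
  have "inj_on ?join ?S"
  proof (rule inj_onI, clarify)
    fix mu nu mu' nu'
    assume *: "subpartition mu lam" "subpartition nu lam'" "subpartition mu' lam" "subpartition nu' lam'"
      and eq: "map (\<lambda>x. x + k) mu @ nu = map (\<lambda>x. x + k) mu' @ nu'"
    have split: "filter (\<lambda>x. k < x) (map (\<lambda>x. x + k) mu @ nu) = map (\<lambda>x. x + k) mu"
      "filter (\<lambda>x. \<not> k < x) (map (\<lambda>x. x + k) mu @ nu) = nu"
      if "subpartition mu lam" "subpartition nu lam'" for mu nu
      using that small[of nu]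
      by (auto simp: subpartition_def is_partition_def filter_map o_def filter_id_conv filter_empty_conv not_less)
    have "map (\<lambda>x. x + k) mu = map (\<lambda>x. x + k) mu'" "nu = nu'"
      using split[OF *(1,2)] split[OF *(3,4)] eq by metis+
    moreover have "inj (\<lambda>x. x + k)" by (simp add: inj_def)
    ultimately show "mu = mu' \<and> nu = nu'" by (metis inj_map_eq_map)
  qed
  moreover have "?join ` ?S \<subseteq> {mu. subpartition mu (map (\<lambda>x. x + k) lam @ lam')}"
  proof clarsimp
    fix mu nu assume *: "subpartition mu lam" "subpartition nu lam'"
    show "subpartition (map (\<lambda>x. x + k) mu @ nu) (map (\<lambda>x. x + k) lam @ lam')"
      unfolding subpartition_def
    proof (intro conjI allI impI)
      show "is_partition (map (\<lambda>x. x + k) mu @ nu)"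
        using * small[OF *(2)]
        by (auto simp: subpartition_def is_partition_def sorted_wrt_append sorted_wrt_map trans_le_add2)
      show "length (map (\<lambda>x. x + k) mu @ nu) \<le> length (map (\<lambda>x. x + k) lam @ lam')"
        using * by (auto simp: subpartition_def)
      fix i assume i: "i < length (map (\<lambda>x. x + k) mu @ nu)"
      show "(map (\<lambda>x. x + k) mu @ nu) ! i \<le> (map (\<lambda>x. x + k) lam @ lam') ! i"
      proof (cases "i < length mu")
        case True
        then show ?thesis using *(1) by (auto simp: subpartition_def nth_append)
      next
        case False
        then have i': "i - length mu < length nu" using i by simp
        show ?thesis
        proof (cases "i < length lam")
          case True
          then show ?thesis using False small[OF *(2)] i'
            by (simp add: nth_append trans_le_add2)
        next
          case False': False
          have "nu ! (i - length mu) \<le> nu ! (i - length lam)"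
            using * i' False' by (intro is_partition_nth_mono) (auto simp: subpartition_def)
          also have "\<dots> \<le> lam' ! (i - length lam)"
            using * i' by (auto simp: subpartition_def)
          finally show ?thesis using False False' by (simp add: nth_append)
        qed
      qed
    qed
  qed
  ultimately have "card ?S \<le> card {mu. subpartition mu (map (\<lambda>x. x + k) lam @ lam')}"
    by (metis card_inj_on_le finite_subpartitions)
  then show ?thesis by (simp add: card_cartesian_product num_subpartitions_def)
qed

lemma num_subpartitions_pos: "0 < num_subpartitions lam"
proof -
  have "subpartition [] lam" by (simp add: subpartition_def is_partition_def)
  then show ?thesis
    unfolding num_subpartitions_def using finite_subpartitions card_gt_0_iff by blast
qed

text \<open>
  Pascal's rule: a subpartition of an \<open>M \<times> k\<close> rectangle either starts with a row of full length \<open>k\<close> or has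
  all its rows in a rectangle that is narrower by one column.
\<close>
lemma binomial_le_num_subpartitions_rectangle:
  "(M + k) choose k \<le> num_subpartitions (replicate M k)"
proof (induction "M + k" arbitrary: M k)
  case 0
  then show ?case using num_subpartitions_pos[of "[]"] by simp
next
  case (Suc s)
  show ?case
  proof (cases "M = 0 \<or> k = 0")
    case True
    then show ?thesis using num_subpartitions_pos[of "replicate M k"] by auto
  next
    case False
    then obtain M' k' where Mk: "M = Suc M'" "k = Suc k'" by (metis not0_implies_Suc)
    let ?A = "{mu. subpartition mu (replicate M k')}"
    let ?B = "{mu. subpartition mu (replicate M' k)}"
    have le: "mu ! i \<le> c" if "subpartition mu (replicate N c)" "i < length mu" for mu N c i
      using that by (auto simp: subpartition_def)
    have "(M + k) choose k = ((M + k') choose k') + ((M' + k) choose k)"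
      by (simp add: Mk)
    also have "\<dots> \<le> card ?A + card ?B"
      using Suc.hyps(1)[of M k'] Suc.hyps(1)[of M' k] Suc.hyps(2)
      by (simp add: Mk num_subpartitions_def)
    also have "card ?B = card ((#) k ` ?B)" by (simp add: card_image)
    also have "card ?A + card ((#) k ` ?B) = card (?A \<union> (#) k ` ?B)"
    proof (rule card_Un_disjoint[symmetric])
      show "?A \<inter> (#) k ` ?B = {}"
        using le[of _ M k' 0] by (fastforce simp: Mk)
    qed (simp_all add: finite_subpartitions)
    also have "\<dots> \<le> card {mu. subpartition mu (replicate M k)}"
    proof (rule card_mono[OF finite_subpartitions], rule Un_least)
      show "?A \<subseteq> {mu. subpartition mu (replicate M k)}"
      proof clarify
        fix mu assume mu: "subpartition mu (replicate M k')"
        then show "subpartition mu (replicate M k)"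
          using le[OF mu] by (simp add: subpartition_def Mk le_SucI del: replicate_Suc)
      qed
      show "(#) k ` ?B \<subseteq> {mu. subpartition mu (replicate M k)}"
      proof clarsimp
        fix mu assume mu: "subpartition mu (replicate M' k)"
        then have "\<forall>x\<in>set mu. x \<le> k" using le[OF mu] by (auto simp: in_set_conv_nth)
        then show "subpartition (k # mu) (replicate M k)"
          using mu by (auto simp: subpartition_def is_partition_def Mk nth_Cons split: nat.splits)
      qed
    qed
    finally show ?thesis by (simp add: num_subpartitions_def)
  qed
qed

lemma sorted_replicate_desc: "sorted_wrt (\<ge>) (replicate M (k :: nat))"
  by (simp add: sorted_wrt_iff_nth_less)

text \<open>
  All steps have width \<open>k\<close>, and the heights are listed from the bottom of the diagram upwards: the entry of
  \<open>Ms\<close> at index \<open>b\<close> is the number of rows of length \<open>(b + 1) * k\<close>.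
\<close>
fun stair :: "nat \<Rightarrow> nat list \<Rightarrow> nat list" where
  "stair k [] = []"
| "stair k (M # Ms) = map (\<lambda>x. x + k) (stair k Ms) @ replicate M k"

lemma is_partition_stair:
  assumes "0 < k"
  shows "is_partition (stair k Ms)"
  by (induction Ms)
    (use assms in \<open>auto simp: is_partition_def sorted_wrt_append sorted_wrt_map sorted_replicate_desc\<close>)

lemma length_stair: "length (stair k Ms) = sum_list Ms"
  by (induction Ms) auto

lemma sum_list_stair: "sum_list (stair k Ms) = k * (\<Sum>b<length Ms. (b + 1) * Ms ! b)"
proof (induction Ms)
  case (Cons M Ms)
  have "sum_list Ms = (\<Sum>b<length Ms. Ms ! b)"
    by (simp add: sum_list_sum_nth atLeast0LessThan)
  then have rows: "(\<Sum>b<length (M # Ms). (b + 1) * (M # Ms) ! b)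
      = M + sum_list Ms + (\<Sum>b<length Ms. (b + 1) * Ms ! b)"
    by (simp add: sum.lessThan_Suc_shift sum.distrib del: sum.lessThan_Suc)
  have "sum_list (stair k (M # Ms)) = sum_list (stair k Ms) + k * sum_list Ms + k * M"
    by (simp add: sum_list_addf length_stair sum_list_replicate sum_list_triv)
  also have "\<dots> = k * (\<Sum>b<length (M # Ms). (b + 1) * (M # Ms) ! b)"
    by (simp only: rows Cons) (simp add: algebra_simps)
  finally show ?case .
qed simp

lemma prod_binomial_le_num_subpartitions_stair:
  "(\<Prod>M\<leftarrow>Ms. (M + k) choose k) \<le> num_subpartitions (stair k Ms)"
proof (induction Ms)
  case Nil
  then show ?case using num_subpartitions_pos[of "[]"] by simp
next
  case (Cons M Ms)
  have "(\<Prod>M\<leftarrow>M # Ms. (M + k) choose k) \<le> num_subpartitions (stair k Ms) * num_subpartitions (replicate M k)"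
    using mult_le_mono[OF Cons binomial_le_num_subpartitions_rectangle[of M k]]
    by (simp add: mult.commute)
  also have "\<dots> \<le> num_subpartitions (stair k (M # Ms))"
    unfolding stair.simps by (intro num_subpartitions_stack) auto
  finally show ?case .
qed

text \<open>Rows of length \<open>1\<close> fill up the size to exactly \<open>n\<close> without losing a subpartition.\<close>
lemma ex_larger_partition:
  assumes "is_partition lam" "sum_list lam \<le> n"
  shows "\<exists>lam'. partition_of n lam' \<and> num_subpartitions lam \<le> num_subpartitions lam'"
proof (intro exI conjI)
  let ?lam' = "lam @ replicate (n - sum_list lam) 1"
  show "partition_of n ?lam'"
    using assms by (fastforce simp: partition_of_def is_partition_def sorted_wrt_append
        sorted_replicate_desc sum_list_replicate Suc_le_eq)
  show "num_subpartitions lam \<le> num_subpartitions ?lam'"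
    using assms(1) by (intro num_subpartitions_mono) (auto simp: subpartition_def nth_append)
qed

lemma ln_fact_bounds:
  "real n * ln (real n) - real n \<le> ln (fact n)"
  "ln (fact n) \<le> (real n + 1) * ln (real n + 1) - real n"
proof (induction n)
  case (Suc n)
  case 1
  have "(real n + 1) * ln (real n + 1) - real n - 1 \<le> real n * ln (real n) - real n + ln (real n + 1)"
  proof (cases "n = 0")
    case False
    then have "ln (real n + 1) - ln (real n) \<le> (real n + 1 - real n) / real n"
      by (intro ln_diff_le) auto
    then show ?thesis using False by (simp add: field_simps)
  qed simp
  also have "\<dots> \<le> ln (fact n) + ln (real n + 1)" using Suc(1) by simp
  finally show ?case by (simp add: ln_mult add.commute)
next
  case (Suc n)
  case 2
  have "ln (real n + 1) - ln (real n + 2) \<le> (real n + 1 - (real n + 2)) / (real n + 2)"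
    by (intro ln_diff_le) auto
  then have "(real n + 2) * (ln (real n + 1) - ln (real n + 2)) \<le> - 1"
    by (simp add: field_simps)
  moreover have "ln (fact (Suc n)) = ln (real n + 1) + ln (fact n)"
    by (simp add: ln_mult add.commute)
  moreover have "real (Suc n) = real n + 1" "real n + 1 + 1 = real n + 2" by simp_all
  ultimately show ?case using Suc(2) by (simp add: algebra_simps)
qed simp_all

text \<open>The exponential growth rate of the binomial coefficient \<open>(\<alpha> s + \<beta> s) choose (\<alpha> s)\<close> for large \<open>s\<close>.\<close>
definition entropy :: "real \<Rightarrow> real \<Rightarrow> real" where
  "entropy \<alpha> \<beta> = (\<alpha> + \<beta>) * ln (\<alpha> + \<beta>) - \<alpha> * ln \<alpha> - \<beta> * ln \<beta>"

lemma ln_binomial_ge: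
  "real (M + k) * ln (real (M + k)) - (real M + 1) * ln (real M + 1) - (real k + 1) * ln (real k + 1)
     \<le> ln (real ((M + k) choose k))"
proof -
  have "real ((M + k) choose k) = fact (M + k) / (fact k * fact M)"
    by (simp add: binomial_fact)
  then have "ln (real ((M + k) choose k)) = ln (fact (M + k)) - ln (fact k) - ln (fact M)"
    by (simp add: ln_div ln_mult)
  then show ?thesis
    using ln_fact_bounds(1)[of "M + k"] ln_fact_bounds(2)[of k] ln_fact_bounds(2)[of M] by simp
qed

lemma nat_floor_ratio_tendsto:
  assumes "0 < \<alpha>"
  shows "(\<lambda>n. real (nat \<lfloor>\<alpha> * sqrt (real n)\<rfloor>) / sqrt (real n)) \<longlonglongrightarrow> \<alpha>"
proof (rule tendsto_sandwich)
  have "\<forall>\<^sub>F n in sequentially. 1 \<le> sqrt (real n)"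
    using sqrt_of_nat_at_top unfolding filterlim_at_top by blast
  then show "\<forall>\<^sub>F n in sequentially. \<alpha> - 1 / sqrt (real n) \<le> real (nat \<lfloor>\<alpha> * sqrt (real n)\<rfloor>) / sqrt (real n)"
  proof eventually_elim
    case (elim n)
    have "\<alpha> * sqrt (real n) - 1 \<le> real (nat \<lfloor>\<alpha> * sqrt (real n)\<rfloor>)" by linarith
    then have "(\<alpha> * sqrt (real n) - 1) / sqrt (real n) \<le> real (nat \<lfloor>\<alpha> * sqrt (real n)\<rfloor>) / sqrt (real n)"
      using elim by (intro divide_right_mono) auto
    then show ?case using elim by (simp add: diff_divide_distrib)
  qed
  show "\<forall>\<^sub>F n in sequentially. real (nat \<lfloor>\<alpha> * sqrt (real n)\<rfloor>) / sqrt (real n) \<le> \<alpha>"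
    using \<open>\<forall>\<^sub>F n in sequentially. 1 \<le> _\<close>
  proof eventually_elim
    case (elim n)
    have "real (nat \<lfloor>\<alpha> * sqrt (real n)\<rfloor>) \<le> \<alpha> * sqrt (real n)"
      using assms by (simp add: of_nat_floor)
    then have "real (nat \<lfloor>\<alpha> * sqrt (real n)\<rfloor>) / sqrt (real n) \<le> \<alpha> * sqrt (real n) / sqrt (real n)"
      using elim by (intro divide_right_mono) auto
    then show ?case using elim by simp
  qed
  show "(\<lambda>n. \<alpha> - 1 / sqrt (real n)) \<longlonglongrightarrow> \<alpha>"
    using tendsto_diff[OF tendsto_const[of \<alpha>] tendsto_divide_0[OF tendsto_const[of 1] filterlim_at_top_imp_at_infinity[OF sqrt_of_nat_at_top]]]
    by simp
qed simp

lemma ln_binomial_rate: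
  assumes "0 < \<alpha>" "0 < \<beta>" "0 < \<epsilon>"
  shows "\<forall>\<^sub>F n in sequentially. (entropy \<alpha> \<beta> - \<epsilon>) * sqrt (real n)
     \<le> ln (real ((nat \<lfloor>\<beta> * sqrt (real n)\<rfloor> + nat \<lfloor>\<alpha> * sqrt (real n)\<rfloor>) choose nat \<lfloor>\<alpha> * sqrt (real n)\<rfloor>))"
proof -
  define s where "s n = sqrt (real n)" for n
  define k where "k n = nat \<lfloor>\<alpha> * s n\<rfloor>" for n
  define M where "M n = nat \<lfloor>\<beta> * s n\<rfloor>" for n
  have inv: "(\<lambda>n. 1 / s n) \<longlonglongrightarrow> 0"
    using tendsto_divide_0[OF tendsto_const[of 1] filterlim_at_top_imp_at_infinity[OF sqrt_of_nat_at_top]]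
    by (simp add: s_def)
  have k: "(\<lambda>n. real (k n) / s n) \<longlonglongrightarrow> \<alpha>" and M: "(\<lambda>n. real (M n) / s n) \<longlonglongrightarrow> \<beta>"
    unfolding k_def M_def s_def using assms by (intro nat_floor_ratio_tendsto; simp)+
  have k1: "(\<lambda>n. (real (k n) + 1) / s n) \<longlonglongrightarrow> \<alpha>"
    using tendsto_add[OF k inv] by (simp add: add_divide_distrib)
  have M1: "(\<lambda>n. (real (M n) + 1) / s n) \<longlonglongrightarrow> \<beta>"
    using tendsto_add[OF M inv] by (simp add: add_divide_distrib)
  have Mk: "(\<lambda>n. (real (M n) + real (k n)) / s n) \<longlonglongrightarrow> \<alpha> + \<beta>"
    using tendsto_add[OF k M] by (simp add: add_divide_distrib add.commute)
  have lns: "(\<lambda>n. ln (s n) / s n) \<longlonglongrightarrow> 0"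
    unfolding s_def by (rule filterlim_compose[OF ln_x_over_x_tendsto_0 sqrt_of_nat_at_top])
  \<comment> \<open>Entropy is homogeneous of degree one: dividing the factorial bounds by \<open>s n\<close> turns all their main terms
    into functions of the ratios; the two shifts by \<open>1\<close> cost the last term, which vanishes in the limit.\<close>
  define E where "E n = (real (M n) + real (k n)) / s n * ln ((real (M n) + real (k n)) / s n)
     - (real (k n) + 1) / s n * ln ((real (k n) + 1) / s n)
     - (real (M n) + 1) / s n * ln ((real (M n) + 1) / s n) - 2 * (ln (s n) / s n)" for n
  have "E \<longlonglongrightarrow> (\<alpha> + \<beta>) * ln (\<alpha> + \<beta>) - \<alpha> * ln \<alpha> - \<beta> * ln \<beta> - 2 * 0"
    unfolding E_def using assms by (intro tendsto_intros k1 M1 Mk lns) auto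
  then have "\<forall>\<^sub>F n in sequentially. entropy \<alpha> \<beta> - \<epsilon> < E n"
    using assms by (intro order_tendstoD) (auto simp: entropy_def)
  moreover have "\<forall>\<^sub>F n in sequentially. 1 \<le> s n"
    using sqrt_of_nat_at_top unfolding filterlim_at_top s_def by blast
  moreover have "\<forall>\<^sub>F n in sequentially. 0 < (real (M n) + real (k n)) / s n"
    using assms by (intro order_tendstoD(1)[OF Mk]) auto
  ultimately show ?thesis unfolding s_def[symmetric] k_def[symmetric] M_def[symmetric]
  proof eventually_elim
    case (elim n)
    have "0 < real (M n) + real (k n)" using elim by (simp add: zero_less_divide_iff)
    have "(entropy \<alpha> \<beta> - \<epsilon>) * s n \<le> E n * s n" using elim by (intro mult_right_mono) auto
    also have "\<dots> = (real (M n) + real (k n)) * (ln (real (M n) + real (k n)) - ln (s n))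
       - (real (k n) + 1) * (ln (real (k n) + 1) - ln (s n))
       - (real (M n) + 1) * (ln (real (M n) + 1) - ln (s n)) - 2 * ln (s n)"
      using elim \<open>0 < real (M n) + real (k n)\<close>
      by (simp add: E_def left_diff_distrib ln_div)
    also have "\<dots> = real (M n + k n) * ln (real (M n + k n)) - (real (M n) + 1) * ln (real (M n) + 1)
        - (real (k n) + 1) * ln (real (k n) + 1)"
      by (simp add: algebra_simps)
    also have "\<dots> \<le> ln (real ((M n + k n) choose k n))" by (rule ln_binomial_ge)
    finally show ?case .
  qed
qed

text \<open>
  \<open>1 / (exp u - 1)\<close> is the mean multiplicity of a part of weight \<open>exp (- u)\<close>. For this ratio of the sides, the
  entropy of a rectangle is that of geometrically distributed multiplicities: \<open>ln\<close> of the Euler factor plus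
  \<open>u\<close> times the mean.
\<close>
lemma entropy_bose:
  assumes u: "0 < u" and h: "0 < h"
  shows "entropy h (h * (1 / (exp u - 1))) = h * (free_energy u + u * (1 / (exp u - 1)))"
proof -
  define q where "q = 1 / (exp u - 1)"
  have e: "1 < exp u" using u by simp
  have q: "0 < q" using e by (simp add: q_def)
  have "1 + q = exp (free_energy u)"
    using e unfolding exp_free_energy[OF u] by (simp add: q_def exp_minus field_simps)
  then have ln1q: "ln (1 + q) = free_energy u" by (metis ln_exp)
  have "q = exp (- u) * (1 + q)"
    using e by (simp add: q_def exp_minus field_simps)
  then have lnq: "ln q = free_energy u - u"
  proof -
    have "q = exp (free_energy u - u)"
      using \<open>q = exp (- u) * (1 + q)\<close> unfolding \<open>1 + q = exp (free_energy u)\<close> by (simp flip: exp_add)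
    then show ?thesis by simp
  qed
  have "ln (h + h * q) = ln h + free_energy u"
    using h q ln1q ln_mult_pos[of h "1 + q"] by (simp add: distrib_left)
  moreover have "ln (h * q) = ln h + (free_energy u - u)"
    using h q lnq by (simp add: ln_mult_pos)
  ultimately have "entropy h (h * q) = h * (free_energy u + u * q)"
    by (simp only: entropy_def) (simp add: algebra_simps)
  then show ?thesis by (simp add: q_def)
qed

text \<open>
  The staircase has about \<open>h * q b * sqrt n\<close> rows of length about \<open>b * h * sqrt n\<close>, where \<open>q b\<close> is the mean
  multiplicity of a part of weight \<open>exp (- v * b)\<close>. Up to rounding down, it has size
  \<open>h\<^sup>2 * A * n\<close>, so \<open>h = 1 / sqrt A\<close> exhausts \<open>n\<close> boxes, and its rate is \<open>S / sqrt A + v * sqrt A\<close>. By the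
  inequality of the arithmetic and the geometric mean this is at least \<open>2 * sqrt (v * S)\<close>, whatever \<open>A\<close>
  is; and \<open>v * S\<close> is close to \<open>pi\<^sup>2 / 6 = decay\<^sup>2\<close>.
\<close>
lemma ex_partition_many_subpartitions:
  assumes "0 < \<epsilon>"
  shows "\<forall>\<^sub>F n in sequentially. \<exists>lam. partition_of n lam \<and>
           exp ((2 * decay - \<epsilon>) * sqrt (real n)) \<le> real (num_subpartitions lam)"
proof -
  have "0 < decay * \<epsilon> / 4" using assms decay_pos by simp
  from free_energy_riemann_sum[OF this] obtain v B where vB: "0 < v" "1 \<le> B"
    "pi\<^sup>2 / 6 - decay * \<epsilon> / 4 < v * (\<Sum>b\<in>{1..B}. free_energy (v * real b))" by blast
  define S where "S = (\<Sum>b\<in>{1..B}. free_energy (v * real b))"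
  define q where "q b = 1 / (exp (v * real b) - 1)" for b
  define A where "A = (\<Sum>b\<in>{1..B}. real b * q b)"
  define h where "h = 1 / sqrt A"
  have q: "0 < q b" if "b \<in> {1..B}" for b using that vB by (simp add: q_def)
  have A: "0 < A" unfolding A_def using q vB by (intro sum_pos) auto
  have h: "0 < h" using A by (simp add: h_def)
  have "0 \<le> S" unfolding S_def free_energy_def
    using vB by (intro sum_nonneg) auto
  have "decay - \<epsilon> / 4 \<le> sqrt (v * S)"
  proof (cases "\<epsilon> \<le> 4 * decay")
    case True
    have "(decay - \<epsilon> / 4)\<^sup>2 \<le> decay\<^sup>2 - decay * \<epsilon> / 4"
      using mult_right_mono[OF True, of \<epsilon>] assms by (simp add: power2_eq_square algebra_simps)
    then show ?thesis using vB(3) by (intro real_le_rsqrt) (simp add: decay_sq S_def)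
  next
    case False
    have "0 \<le> sqrt (v * S)" using vB \<open>0 \<le> S\<close> by simp
    then show ?thesis using False by linarith
  qed
  also have "sqrt (v * S) = sqrt ((S / sqrt A) * (v * sqrt A))" using A by simp
  also have "\<dots> \<le> (S / sqrt A + v * sqrt A) / 2"
    using A \<open>0 \<le> S\<close> vB by (intro arith_geo_mean_sqrt) auto
  also have "S / sqrt A + v * sqrt A = h * S + h * v * A"
  proof -
    have "A / sqrt A = sqrt A" using A by (simp add: real_div_sqrt)
    then have "h * v * A = v * sqrt A" by (simp add: h_def flip: times_divide_eq_right)
    then show ?thesis by (simp add: h_def)
  qed
  also have "\<dots> = (\<Sum>b\<in>{1..B}. h * (free_energy (v * real b) + v * real b * q b))"
    by (simp add: S_def A_def sum_distrib_left sum.distrib algebra_simps)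
  also have "\<dots> = (\<Sum>b\<in>{1..B}. entropy h (h * q b))"
    unfolding q_def using vB h by (intro sum.cong refl entropy_bose[symmetric]) auto
  finally have rate: "2 * decay - \<epsilon> / 2 \<le> (\<Sum>b\<in>{1..B}. entropy h (h * q b))" by simp
  define k where "k n = nat \<lfloor>h * sqrt (real n)\<rfloor>" for n
  define M where "M n b = nat \<lfloor>h * q b * sqrt (real n)\<rfloor>" for n b
  have "\<forall>\<^sub>F n in sequentially. \<forall>b\<in>{1..B}. (entropy h (h * q b) - \<epsilon> / (2 * B)) * sqrt (real n)
     \<le> ln (real ((M n b + k n) choose k n))"
    unfolding k_def M_def using h q assms vB
    by (intro eventually_ball_finite ballI ln_binomial_rate) auto
  moreover have "\<forall>\<^sub>F n in sequentially. max 1 (1 / h) \<le> sqrt (real n)"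
    using sqrt_of_nat_at_top unfolding filterlim_at_top by blast
  ultimately show ?thesis
  proof eventually_elim
    case (elim n)
    define s where "s = sqrt (real n)"
    have s: "1 \<le> s" "1 / h \<le> s" "s * s = real n" using elim(2) by (auto simp: s_def)
    have "1 \<le> h * s" using s(2) h by (simp add: field_simps)
    then have k: "0 < k n" unfolding k_def s_def[symmetric] by linarith
    have k_le: "real (k n) \<le> h * s" using \<open>1 \<le> h * s\<close> by (simp add: k_def flip: s_def)
    have M_le: "real (M n b) \<le> h * q b * s" if "b \<in> {1..B}" for b
      using h q[OF that] s by (simp add: M_def of_nat_floor flip: s_def)
    define Ms where "Ms = map (M n) [1..<Suc B]"
    have "real (sum_list (stair (k n) Ms)) = real (k n) * (\<Sum>b<B. real (Suc b) * real (M n (Suc b)))"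
      by (simp add: sum_list_stair Ms_def algebra_simps del: upt_Suc)
    also have "(\<Sum>b<B. real (Suc b) * real (M n (Suc b))) = (\<Sum>b\<in>{1..B}. real b * real (M n b))"
      by (simp add: sum.atLeast1_atMost_eq)
    also have "real (k n) * \<dots> \<le> (h * s) * (\<Sum>b\<in>{1..B}. real b * (h * q b * s))"
      using k_le M_le h s by (intro mult_mono sum_mono mult_left_mono sum_nonneg) auto
    also have "\<dots> = (h * h * A) * (s * s)"
      by (simp add: A_def sum_distrib_left mult_ac)
    also have "\<dots> = real n" using A s by (simp add: h_def)
    finally have size: "sum_list (stair (k n) Ms) \<le> n" by simp
    from ex_larger_partition[OF is_partition_stair[OF k] size]
    obtain lam where lam: "partition_of n lam" "num_subpartitions (stair (k n) Ms) \<le> num_subpartitions lam"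
      by blast
    have "(2 * decay - \<epsilon>) * s \<le> ((\<Sum>b\<in>{1..B}. entropy h (h * q b)) - \<epsilon> / 2) * s"
      using rate s by (intro mult_right_mono) auto
    also have "\<dots> = (\<Sum>b\<in>{1..B}. (entropy h (h * q b) - \<epsilon> / (2 * B)) * s)"
      using vB by (simp add: sum_subtractf flip: sum_distrib_right)
    also have "\<dots> \<le> (\<Sum>b\<in>{1..B}. ln (real ((M n b + k n) choose k n)))"
      using elim(1) by (intro sum_mono) (auto simp: s_def)
    finally have "exp ((2 * decay - \<epsilon>) * s) \<le> exp (\<Sum>b\<in>{1..B}. ln (real ((M n b + k n) choose k n)))"
      by simp
    also have "\<dots> = (\<Prod>b\<in>{1..B}. real ((M n b + k n) choose k n))"
      by (simp add: exp_sum)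
    also have "\<dots> = real (\<Prod>M\<leftarrow>Ms. (M + k n) choose k n)"
      using prod.distinct_set_conv_list[of "[1..<Suc B]" "\<lambda>b. (M n b + k n) choose k n"]
      by (simp add: Ms_def o_def atLeastLessThanSuc_atLeastAtMost del: upt_Suc flip: of_nat_prod)
    also have "\<dots> \<le> real (num_subpartitions (stair (k n) Ms))"
      using prod_binomial_le_num_subpartitions_stair of_nat_mono by blast
    also have "\<dots> \<le> real (num_subpartitions lam)" using lam by simp
    finally show ?case using lam by (auto simp: s_def)
  qed
qed

section \<open>Maximizers fill the region below the curve\<close>

lemma maximizer_lower:
  assumes "\<forall>n\<ge>1. maximizes_subpartitions n (lam n)" "0 < \<epsilon>"
  shows "\<forall>\<^sub>F n in sequentially. exp ((2 * decay - \<epsilon>) * sqrt (real n)) \<le> real (num_subpartitions (lam n))"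
  using ex_partition_many_subpartitions[OF assms(2)] eventually_ge_at_top[of 1]
proof eventually_elim
  case (elim n)
  then obtain mu where mu: "partition_of n mu"
    "exp ((2 * decay - \<epsilon>) * sqrt (real n)) \<le> real (num_subpartitions mu)" by blast
  note mu(2)
  also have "real (num_subpartitions mu) \<le> real (num_subpartitions (lam n))"
    using assms(1) elim mu(1) by (simp add: maximizes_subpartitions_def)
  finally show ?case .
qed

lemma maximizer_contains_cells:
  assumes max: "\<forall>n\<ge>1. maximizes_subpartitions n (lam n)"
    and below: "0 < \<tau>" "1 < exp (- decay * \<sigma>) + exp (- decay * \<tau>)"
  shows "\<forall>\<^sub>F n in sequentially. \<forall>i j. real i \<le> \<sigma> * sqrt (real n) \<and> real j + 1 \<le> \<tau> * sqrt (real n)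
           \<longrightarrow> (i, j) \<in> cells (lam n)"
proof -
  from missing_cell_saving[OF below] obtain \<delta> where \<delta>: "0 < \<delta>"
    "\<forall>\<^sub>F n in sequentially. \<forall>i j lam.
           partition_of n lam \<and> (i, j) \<notin> cells lam \<and>
           real i \<le> \<sigma> * sqrt (real n) \<and> real j + 1 \<le> \<tau> * sqrt (real n) \<longrightarrow>
           real (num_subpartitions lam) \<le> exp ((2 * decay - \<delta>) * sqrt (real n))" by blast
  have "0 < \<delta> / 2" using \<delta> by simp
  from maximizer_lower[OF max this] \<delta>(2) eventually_ge_at_top[of 1]
  show ?thesis
  proof eventually_elim
    case (elim n)
    have "partition_of n (lam n)" using max elim by (simp add: maximizes_subpartitions_def)
    moreover have "exp ((2 * decay - \<delta>) * sqrt (real n)) < exp ((2 * decay - \<delta> / 2) * sqrt (real n))"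
      using \<delta> elim by simp
    ultimately have "\<not> real (num_subpartitions (lam n)) \<le> exp ((2 * decay - \<delta>) * sqrt (real n))"
      using elim(1) by linarith
    then show ?case using elim(2) \<open>partition_of n (lam n)\<close> by blast
  qed
qed

text \<open>
  Uniformity comes from a finite grid of mesh \<open>g\<close>. A point at distance about \<open>\<delta> / decay\<close> below the curve can
  be rounded up to a grid point that is still strictly below it, and only grid points in a bounded square
  occur. The second coordinate is rounded up by one step more, which absorbs the difference between \<open>j\<close> and
  \<open>j + 1\<close>.
\<close>
lemma maximizer_contains_uniformly:
  assumes max: "\<forall>n\<ge>1. maximizes_subpartitions n (lam n)" and \<delta>: "0 < \<delta>"
  shows "\<forall>\<^sub>F n in sequentially. \<forall>\<sigma>\<ge>0. \<forall>\<tau>\<ge>0. exp \<delta> \<le> exp (- decay * \<sigma>) + exp (- decay * \<tau>)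
           \<longrightarrow> (nat \<lfloor>\<sigma> * sqrt (real n)\<rfloor>, nat \<lfloor>\<tau> * sqrt (real n)\<rfloor>) \<in> cells (lam n)"
proof -
  define g where "g = \<delta> / (4 * decay)"
  have g: "0 < g" using \<delta> decay_pos by (simp add: g_def)
  define R where "R = - ln (exp \<delta> - 1) / decay"
  define P where "P = nat \<lfloor>R / g\<rfloor>"
  have "\<forall>\<^sub>F n in sequentially. \<forall>(p, q)\<in>{..P} \<times> {..P}.
      1 < exp (- decay * ((real p + 1) * g)) + exp (- decay * ((real q + 2) * g)) \<longrightarrow>
      (\<forall>i j. real i \<le> (real p + 1) * g * sqrt (real n) \<and> real j + 1 \<le> (real q + 2) * g * sqrt (real n)
           \<longrightarrow> (i, j) \<in> cells (lam n))"
  proof (intro eventually_ball_finite ballI)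
    fix pq assume "pq \<in> {..P} \<times> {..P}"
    obtain p q where pq: "pq = (p, q)" by force
    show "\<forall>\<^sub>F n in sequentially. case pq of (p, q) \<Rightarrow>
      1 < exp (- decay * ((real p + 1) * g)) + exp (- decay * ((real q + 2) * g)) \<longrightarrow>
      (\<forall>i j. real i \<le> (real p + 1) * g * sqrt (real n) \<and> real j + 1 \<le> (real q + 2) * g * sqrt (real n)
           \<longrightarrow> (i, j) \<in> cells (lam n))"
    proof (cases "1 < exp (- decay * ((real p + 1) * g)) + exp (- decay * ((real q + 2) * g))")
      case True
      have "0 < (real q + 2) * g" using g by simp
      from maximizer_contains_cells[OF max this True] show ?thesis unfolding pq
        by (auto elim: eventually_mono)
    qed (simp add: pq)
  qed simp
  moreover have "\<forall>\<^sub>F n in sequentially. 1 / g \<le> sqrt (real n)"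
    using sqrt_of_nat_at_top unfolding filterlim_at_top by blast
  ultimately show ?thesis
  proof (eventually_elim, intro allI impI)
    fix n and \<sigma> \<tau> :: real
    assume grid: "\<forall>(p, q)\<in>{..P} \<times> {..P}.
      1 < exp (- decay * ((real p + 1) * g)) + exp (- decay * ((real q + 2) * g)) \<longrightarrow>
      (\<forall>i j. real i \<le> (real p + 1) * g * sqrt (real n) \<and> real j + 1 \<le> (real q + 2) * g * sqrt (real n)
           \<longrightarrow> (i, j) \<in> cells (lam n))"
      and large: "1 / g \<le> sqrt (real n)"
      and \<sigma>: "0 \<le> \<sigma>" and \<tau>: "0 \<le> \<tau>" and below: "exp \<delta> \<le> exp (- decay * \<sigma>) + exp (- decay * \<tau>)"
    define p where "p = nat \<lfloor>\<sigma> / g\<rfloor>"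
    define q where "q = nat \<lfloor>\<tau> / g\<rfloor>"
    have bound: "\<rho> \<le> R" if "exp \<delta> - 1 \<le> exp (- decay * \<rho>)" for \<rho>
    proof -
      have "ln (exp \<delta> - 1) \<le> - decay * \<rho>"
        using ln_mono[OF that] \<delta> by simp
      then show ?thesis using decay_pos by (simp add: R_def field_simps)
    qed
    have "exp (- decay * \<sigma>) \<le> 1" "exp (- decay * \<tau>) \<le> 1"
      using \<sigma> \<tau> decay_pos by simp_all
    then have "exp \<delta> - 1 \<le> exp (- decay * \<sigma>)" "exp \<delta> - 1 \<le> exp (- decay * \<tau>)"
      using below by linarith+
    then have "\<sigma> \<le> R" "\<tau> \<le> R" using bound by blast+
    then have pqP: "p \<le> P" "q \<le> P" unfolding p_def q_def P_def
      using g by (auto intro!: nat_mono floor_mono divide_right_mono)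
    have p: "real p * g \<le> \<sigma>" "\<sigma> \<le> (real p + 1) * g" and q: "real q * g \<le> \<tau>" "\<tau> \<le> (real q + 1) * g"
    proof -
      have "real p \<le> \<sigma> / g" "\<sigma> / g \<le> real p + 1" "real q \<le> \<tau> / g" "\<tau> / g \<le> real q + 1"
        using \<sigma> \<tau> g by (auto simp: p_def q_def)
      then show "real p * g \<le> \<sigma>" "\<sigma> \<le> (real p + 1) * g" "real q * g \<le> \<tau>" "\<tau> \<le> (real q + 1) * g"
        using g by (simp_all add: field_simps)
    qed
    have "1 < exp (\<delta> / 2)" using \<delta> by simp
    also have "\<dots> = exp (- (\<delta> / 2)) * exp \<delta>" by (simp flip: exp_add)
    also have "\<dots> \<le> exp (- (\<delta> / 2)) * (exp (- decay * \<sigma>) + exp (- decay * \<tau>))"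
      using below by (intro mult_left_mono) auto
    also have "\<dots> = exp (- decay * (\<sigma> + 2 * g)) + exp (- decay * (\<tau> + 2 * g))"
    proof -
      have "decay * (2 * g) = \<delta> / 2" using decay_pos by (simp add: g_def)
      then have "- decay * (\<rho> + 2 * g) = - (\<delta> / 2) + - decay * \<rho>" for \<rho>
        by (simp add: distrib_left)
      then show ?thesis by (simp only: exp_add distrib_left)
    qed
    also have "\<dots> \<le> exp (- decay * ((real p + 1) * g)) + exp (- decay * ((real q + 2) * g))"
    proof -
      have "(real p + 1) * g \<le> \<sigma> + 2 * g" "(real q + 2) * g \<le> \<tau> + 2 * g"
        using p q g by (auto simp: algebra_simps)
      then show ?thesis using decay_pos by (intro add_mono) auto
    qed
    finally have *: "\<And>i j. real i \<le> (real p + 1) * g * sqrt (real n) \<Longrightarrow> real j + 1 \<le> (real q + 2) * g * sqrt (real n)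
           \<Longrightarrow> (i, j) \<in> cells (lam n)"
      using grid pqP by auto
    show "(nat \<lfloor>\<sigma> * sqrt (real n)\<rfloor>, nat \<lfloor>\<tau> * sqrt (real n)\<rfloor>) \<in> cells (lam n)"
    proof (rule *)
      have "real (nat \<lfloor>\<sigma> * sqrt (real n)\<rfloor>) \<le> \<sigma> * sqrt (real n)" using \<sigma> by (simp add: of_nat_floor)
      also have "\<dots> \<le> (real p + 1) * g * sqrt (real n)" using p by (intro mult_right_mono) auto
      finally show "real (nat \<lfloor>\<sigma> * sqrt (real n)\<rfloor>) \<le> (real p + 1) * g * sqrt (real n)" .
      have "real (nat \<lfloor>\<tau> * sqrt (real n)\<rfloor>) + 1 \<le> \<tau> * sqrt (real n) + 1" using \<tau> by (simp add: of_nat_floor)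
      also have "\<dots> \<le> (real q + 1) * g * sqrt (real n) + g * sqrt (real n)"
        using q large g by (intro add_mono mult_right_mono) (auto simp: field_simps)
      also have "\<dots> = (real q + 2) * g * sqrt (real n)" by (simp add: algebra_simps)
      finally show "real (nat \<lfloor>\<tau> * sqrt (real n)\<rfloor>) + 1 \<le> (real q + 2) * g * sqrt (real n)" .
    qed
  qed
qed

section \<open>Convergence of the boundary functions\<close>

definition limit_shape :: "real \<Rightarrow> real" where
  "limit_shape x = 2 * sqrt 3 / pi * ln (2 * cosh (pi / (2 * sqrt 3) * x))"

text \<open>
  In the rotated coordinates \<open>x = (\<sigma> - \<tau>) / sqrt 2\<close>, \<open>y = (\<sigma> + \<tau>) / sqrt 2\<close>, the vertical distance to the graph
  of \<open>limit_shape\<close> is read off from \<open>exp (- decay * \<sigma>) + exp (- decay * \<tau>)\<close>; the graph itself is the curve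
  where this sum is \<open>1\<close>.
\<close>
lemma limit_shape_curve:
  "exp (- decay * ((y + x) / sqrt 2)) + exp (- decay * ((y - x) / sqrt 2))
     = exp (decay / sqrt 2 * (limit_shape x - y))"
proof -
  define c where "c = decay / sqrt 2"
  have c: "c = pi / (2 * sqrt 3)"
  proof -
    have "sqrt 6 * sqrt 2 = sqrt 12" by (simp flip: real_sqrt_mult)
    also have "\<dots> = sqrt (4 * 3)" by simp
    also have "\<dots> = 2 * sqrt 3" by (simp only: real_sqrt_mult) simp
    finally show ?thesis by (simp add: c_def decay_def)
  qed
  have "c * limit_shape x = ln (2 * cosh (c * x))"
    by (simp add: limit_shape_def c)
  then have "exp (c * (limit_shape x - y)) = 2 * cosh (c * x) * exp (- c * y)"
    by (simp add: right_diff_distrib exp_diff exp_minus divide_inverse cosh_real_pos)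
  also have "\<dots> = exp (- c * (y + x)) + exp (- c * (y - x))"
    by (simp add: cosh_def algebra_simps flip: exp_add)
  finally show ?thesis by (simp add: c_def)
qed

lemma abs_less_limit_shape: "\<bar>x\<bar> < limit_shape x"
proof -
  have "1 < exp (- decay * ((\<bar>x\<bar> + x) / sqrt 2)) + exp (- decay * ((\<bar>x\<bar> - x) / sqrt 2))"
    by (cases "x \<ge> 0") auto
  then have "1 < exp (decay / sqrt 2 * (limit_shape x - \<bar>x\<bar>))"
    by (simp only: limit_shape_curve)
  then show ?thesis using decay_pos by (simp add: zero_less_divide_iff zero_less_mult_iff)
qed

lemma abs_le_boundary: "\<bar>x\<bar> \<le> boundary lam x"
  by (rule boundary_greatest(2)) (auto simp: russian_diagram_def)

lemma boundary_ge_if_cell: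
  assumes "(i, j) \<in> cells lam" "real i \<le> s" "s \<le> real i + 1" "real j \<le> t" "t \<le> real j + 1"
  shows "(s + t) / sqrt 2 \<le> boundary lam ((s - t) / sqrt 2)"
proof (rule boundary_greatest(2))
  have "((s - t) / sqrt 2, (s + t) / sqrt 2) \<in> russian_box i j"
    using assms unfolding russian_box_def by blast
  then show "((s - t) / sqrt 2, (s + t) / sqrt 2) \<in> russian_diagram lam"
    using assms(1) by (auto simp: russian_diagram_def cells_def)
qed

lemma boundary_cell:
  assumes "\<bar>x\<bar> < boundary lam x"
  obtains i j where "(i, j) \<in> cells lam"
    "(boundary lam x + x) / sqrt 2 \<le> real i + 1" "(boundary lam x - x) / sqrt 2 \<le> real j + 1"
proof -
  define y where "y = boundary lam x"
  have "(x, y) \<in> russian_diagram lam" unfolding y_def by (rule boundary_greatest(1))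
  moreover have "y \<noteq> \<bar>x\<bar>" using assms by (simp add: y_def)
  ultimately obtain i j where ij: "(i, j) \<in> cells lam" "(x, y) \<in> russian_box i j"
    by (auto simp: russian_diagram_def cells_def)
  then obtain s t where st: "x = (s - t) / sqrt 2" "y = (s + t) / sqrt 2"
    "s \<le> real i + 1" "t \<le> real j + 1" unfolding russian_box_def by blast
  have "(y + x) / sqrt 2 = s" "(y - x) / sqrt 2 = t"
    by (simp_all add: st(1,2) field_simps)
  then show ?thesis using ij st that by (simp add: y_def)
qed

text \<open>
  The point at distance \<open>\<epsilon>\<close> below the graph either lies below the graph of \<open>|x|\<close>, which every boundary
  dominates, or it lies in a cell that the maximizer contains.
\<close>
lemma rescaled_boundary_lower:
  assumes max: "\<forall>n\<ge>1. maximizes_subpartitions n (lam n)" and \<epsilon>: "0 < \<epsilon>"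
  shows "\<forall>\<^sub>F n in sequentially. \<forall>x. limit_shape x - \<epsilon> \<le> rescaled_boundary (lam n) x"
proof -
  have "0 < decay / sqrt 2 * \<epsilon>" using decay_pos \<epsilon> by simp
  from maximizer_contains_uniformly[OF max this] eventually_ge_at_top[of 1]
  show ?thesis
  proof (eventually_elim, intro allI)
    fix n x
    assume inside: "\<forall>\<sigma>\<ge>0. \<forall>\<tau>\<ge>0. exp (decay / sqrt 2 * \<epsilon>) \<le> exp (- decay * \<sigma>) + exp (- decay * \<tau>)
           \<longrightarrow> (nat \<lfloor>\<sigma> * sqrt (real n)\<rfloor>, nat \<lfloor>\<tau> * sqrt (real n)\<rfloor>) \<in> cells (lam n)"
      and n: "1 \<le> n"
    define r where "r = sqrt (real n)"
    have r: "0 < r" using n by (simp add: r_def)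
    have resc: "rescaled_boundary (lam n) x = boundary (lam n) (r * x) / r"
      using max n by (simp add: rescaled_boundary_def r_def maximizes_subpartitions_def partition_of_def)
    define y where "y = limit_shape x - \<epsilon>"
    show "limit_shape x - \<epsilon> \<le> rescaled_boundary (lam n) x"
    proof (cases "y \<le> \<bar>x\<bar>")
      case True
      have "y * r \<le> \<bar>r * x\<bar>" using True r by (simp add: abs_mult mult.commute)
      also have "\<dots> \<le> boundary (lam n) (r * x)" by (rule abs_le_boundary)
      finally show ?thesis using r by (simp add: resc pos_le_divide_eq flip: y_def)
    next
      case False
      define \<sigma> where "\<sigma> = (y + x) / sqrt 2"
      define \<tau> where "\<tau> = (y - x) / sqrt 2"
      have pos: "0 \<le> \<sigma>" "0 \<le> \<tau>" using False by (auto simp: \<sigma>_def \<tau>_def)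
      have "exp (decay / sqrt 2 * \<epsilon>) = exp (- decay * \<sigma>) + exp (- decay * \<tau>)"
        unfolding \<sigma>_def \<tau>_def limit_shape_curve by (simp add: y_def)
      then have cell: "(nat \<lfloor>\<sigma> * r\<rfloor>, nat \<lfloor>\<tau> * r\<rfloor>) \<in> cells (lam n)"
        using inside pos by (simp add: r_def)
      have "0 \<le> \<sigma> * r" "0 \<le> \<tau> * r" using pos r by auto
      then have "(\<sigma> * r + \<tau> * r) / sqrt 2 \<le> boundary (lam n) ((\<sigma> * r - \<tau> * r) / sqrt 2)"
        by (intro boundary_ge_if_cell[OF cell]) linarith+
      moreover have "(\<sigma> * r + \<tau> * r) / sqrt 2 = y * r" "(\<sigma> * r - \<tau> * r) / sqrt 2 = r * x"
        by (simp_all add: \<sigma>_def \<tau>_def field_simps)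
      ultimately show ?thesis using r by (simp add: resc pos_le_divide_eq flip: y_def)
    qed
  qed
qed

text \<open>
  The region below the curve has area \<open>1\<close>, since its height \<open>free_energy (decay * \<tau>) / decay\<close> at \<open>\<tau>\<close> has
  integral \<open>(pi\<^sup>2 / 6) / decay\<^sup>2\<close>. The Riemann sum with right end points is a staircase in this region; lowering
  all its steps by a small \<open>\<kappa>\<close> moves the corners strictly below the curve.
\<close>
lemma ex_inner_stair:
  assumes "0 < \<eta>"
  obtains h B l where "0 < h" "1 - \<eta> < h * (\<Sum>m<B. l m)"
    "\<And>m. 1 < exp (- decay * l m) + exp (- decay * (real (Suc m) * h))"
proof -
  have "0 < decay\<^sup>2 * \<eta> / 2" using assms decay_pos by simp
  from free_energy_riemann_sum[OF this] obtain v B where vB: "0 < v" "1 \<le> B"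
    "pi\<^sup>2 / 6 - decay\<^sup>2 * \<eta> / 2 < v * (\<Sum>b\<in>{1..B}. free_energy (v * real b))" by blast
  define h where "h = v / decay"
  define \<kappa> where "\<kappa> = \<eta> / (2 * h * real B)"
  define l where "l m = free_energy (v * real (Suc m)) / decay - \<kappa>" for m
  have h: "0 < h" using vB decay_pos by (simp add: h_def)
  have \<kappa>: "0 < \<kappa>" using h vB assms by (simp add: \<kappa>_def)
  show ?thesis
  proof (rule that[OF h])
    have "decay\<^sup>2 * (1 - \<eta> / 2) < v * (\<Sum>m<B. free_energy (v * real (Suc m)))"
      using vB(3) by (simp add: decay_sq[symmetric] sum.atLeast1_atMost_eq algebra_simps)
    then have "1 - \<eta> / 2 < v * (\<Sum>m<B. free_energy (v * real (Suc m))) / decay\<^sup>2"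
      using decay_pos by (simp add: pos_less_divide_eq mult.commute)
    also have "\<dots> = h * (\<Sum>m<B. free_energy (v * real (Suc m)) / decay)"
      by (simp add: h_def power2_eq_square flip: sum_divide_distrib)
    finally have "1 - \<eta> / 2 - h * real B * \<kappa> < h * (\<Sum>m<B. l m)"
      by (simp add: l_def sum_subtractf algebra_simps)
    moreover have "h * real B * \<kappa> = \<eta> / 2" using h vB by (simp add: \<kappa>_def)
    ultimately show "1 - \<eta> < h * (\<Sum>m<B. l m)" by simp
    fix m
    define u where "u = v * real (Suc m)"
    have u: "0 < u" using vB by (simp add: u_def)
    have "1 - exp (- u) = exp (- free_energy u)" unfolding exp_minus[of "free_energy u"] exp_free_energy[OF u] by simp
    also have "\<dots> < exp (- decay * l m)"
      unfolding l_def u_def[symmetric] using decay_pos \<kappa> by (simp add: right_diff_distrib)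
    finally show "1 < exp (- decay * l m) + exp (- decay * (real (Suc m) * h))"
      using decay_pos by (simp add: h_def u_def mult.commute)
  qed
qed

lemma card_stair_cells:
  fixes p :: "nat \<Rightarrow> nat"
  shows "card {(i, j). j < B * k \<and> i < p (j div k)} = k * (\<Sum>m<B. p m)"
proof -
  have "{(i, j). j < B * k \<and> i < p (j div k)}
      = prod.swap ` (SIGMA j:{..<B * k}. {..<p (j div k)})" by force
  also have "card \<dots> = card (SIGMA j:{..<B * k}. {..<p (j div k)})"
    by (rule card_image) simp
  also have "\<dots> = (\<Sum>j<B * k. p (j div k))" by simp
  also have "\<dots> = (\<Sum>m<B. \<Sum>j\<in>{m * k..<m * k + k}. p (j div k))"
    by (rule sum.nat_group[symmetric])
  also have "\<dots> = (\<Sum>m<B. \<Sum>j\<in>{m * k..<m * k + k}. p m)"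
  proof (intro sum.cong refl)
    fix m j assume "j \<in> {m * k..<m * k + k}"
    then have "j div k = m" by (intro div_nat_eqI) (auto simp: mult.commute)
    then show "p (j div k) = p m" by simp
  qed
  finally show ?thesis by (simp add: sum_distrib_left)
qed

text \<open>
  A boundary point \<open>\<epsilon>\<close> above the graph belongs to a cell \<open>(i, j)\<close>, and the diagram contains the square \<open>Sq\<close> of
  side about \<open>e * sqrt n\<close> with this outer corner. The choice \<open>e = \<epsilon> / 2 < \<epsilon> / sqrt 2\<close> keeps the whole square
  above the curve, so it is disjoint from a staircase \<open>St\<close> with corners below the curve. If the staircase
  has area greater than \<open>(1 - e\<^sup>2) * n\<close>, then both together need more than \<open>n\<close> cells.
\<close>
lemma rescaled_boundary_upper:
  assumes max: "\<forall>n\<ge>1. maximizes_subpartitions n (lam n)" and \<epsilon>: "0 < \<epsilon>"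
  shows "\<forall>\<^sub>F n in sequentially. \<forall>x. rescaled_boundary (lam n) x \<le> limit_shape x + \<epsilon>"
proof -
  define e where "e = \<epsilon> / 2"
  have e: "0 < e" using \<epsilon> by (simp add: e_def)
  then have "0 < e\<^sup>2" by simp
  obtain h B l where hl: "0 < h" "1 - e\<^sup>2 < h * (\<Sum>m<B. l m)"
    "\<And>m. 1 < exp (- decay * l m) + exp (- decay * (real (Suc m) * h))"
    by (rule ex_inner_stair[OF \<open>0 < e\<^sup>2\<close>]) blast
  define L where "L = (\<Sum>m<B. l m)"
  have "\<forall>\<^sub>F n in sequentially. \<forall>m\<in>{..<B}. \<forall>i j. real i \<le> l m * sqrt (real n) \<and>
      real j + 1 \<le> real (Suc m) * h * sqrt (real n) \<longrightarrow> (i, j) \<in> cells (lam n)"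
    using hl by (intro eventually_ball_finite ballI maximizer_contains_cells[OF max]) auto
  moreover have "\<forall>\<^sub>F n in sequentially. 1 < (h - 1 / sqrt (real n)) * (L - real B / sqrt (real n)) + (e - 1 / sqrt (real n))\<^sup>2
      \<and> 0 < h - 1 / sqrt (real n) \<and> 0 < e - 1 / sqrt (real n)"
  proof -
    have inv: "(\<lambda>n. c / sqrt (real n)) \<longlonglongrightarrow> 0" for c
      using tendsto_divide_0[OF tendsto_const filterlim_at_top_imp_at_infinity[OF sqrt_of_nat_at_top]] .
    have lim: "(\<lambda>n. c - d / sqrt (real n)) \<longlonglongrightarrow> c" for c d
      using tendsto_diff[OF tendsto_const[of c] inv[of d]] by simp
    have "(\<lambda>n. (h - 1 / sqrt (real n)) * (L - real B / sqrt (real n)) + (e - 1 / sqrt (real n))\<^sup>2) \<longlonglongrightarrow> h * L + e\<^sup>2"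
      by (intro tendsto_add tendsto_mult tendsto_power lim)
    then show ?thesis using hl e
      by (intro eventually_conj order_tendstoD(1)[OF lim] order_tendstoD(1)) (auto simp: L_def)
  qed
  ultimately show ?thesis using eventually_ge_at_top[of "1 :: nat"]
  proof (eventually_elim, intro allI)
    fix n x
    assume inside: "\<forall>m\<in>{..<B}. \<forall>i j. real i \<le> l m * sqrt (real n) \<and>
        real j + 1 \<le> real (Suc m) * h * sqrt (real n) \<longrightarrow> (i, j) \<in> cells (lam n)"
      and large: "1 < (h - 1 / sqrt (real n)) * (L - real B / sqrt (real n)) + (e - 1 / sqrt (real n))\<^sup>2
        \<and> 0 < h - 1 / sqrt (real n) \<and> 0 < e - 1 / sqrt (real n)"
      and n: "1 \<le> n"
    show "rescaled_boundary (lam n) x \<le> limit_shape x + \<epsilon>"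
    proof (rule ccontr)
      assume above: "\<not> rescaled_boundary (lam n) x \<le> limit_shape x + \<epsilon>"
      define r where "r = sqrt (real n)"
      have r: "0 < r" "r * r = real n" using n by (auto simp: r_def)
      have lam: "is_partition (lam n)" "sum_list (lam n) = n"
        using max n by (auto simp: maximizes_subpartitions_def partition_of_def)
      define y where "y = rescaled_boundary (lam n) x"
      have yr: "boundary (lam n) (r * x) = r * y"
        using r lam by (simp add: y_def rescaled_boundary_def r_def)
      have y: "limit_shape x + \<epsilon> < y" using above by (simp add: y_def)
      then have "\<bar>x\<bar> < y" using abs_less_limit_shape[of x] \<epsilon> by linarith
      then have "\<bar>r * x\<bar> < boundary (lam n) (r * x)"
        unfolding yr using r by (simp add: abs_mult)
      from boundary_cell[OF this] obtain i j where ij: "(i, j) \<in> cells (lam n)"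
        "(r * y + r * x) / sqrt 2 \<le> real i + 1" "(r * y - r * x) / sqrt 2 \<le> real j + 1"
        unfolding yr by blast
      define \<sigma> where "\<sigma> = (y + x) / sqrt 2"
      define \<tau> where "\<tau> = (y - x) / sqrt 2"
      have corner: "\<sigma> * r \<le> real i + 1" "\<tau> * r \<le> real j + 1"
        using ij(2,3) by (simp_all add: \<sigma>_def \<tau>_def algebra_simps)
      have outside: "exp (- decay * (\<sigma> - e)) + exp (- decay * (\<tau> - e)) < 1"
      proof -
        have "exp (- decay * (\<sigma> - e)) + exp (- decay * (\<tau> - e))
            = exp (decay * e) * (exp (- decay * \<sigma>) + exp (- decay * \<tau>))"
          by (simp add: algebra_simps flip: exp_add)
        also have "\<dots> = exp (decay * e + decay / sqrt 2 * (limit_shape x - y))"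
          unfolding \<sigma>_def \<tau>_def limit_shape_curve by (simp flip: exp_add)
        also have "decay * e + decay / sqrt 2 * (limit_shape x - y) < 0"
        proof -
          have "sqrt 2 < 2" by (simp add: real_less_lsqrt)
          then have "e < \<epsilon> / sqrt 2" using \<epsilon> unfolding e_def by (intro divide_strict_left_mono) auto
          moreover have "\<epsilon> / sqrt 2 < (y - limit_shape x) / sqrt 2" using y by (simp add: divide_strict_right_mono)
          ultimately have "e < (y - limit_shape x) / sqrt 2" by linarith
          from mult_strict_left_mono[OF this decay_pos]
          have "decay * e < decay * ((y - limit_shape x) / sqrt 2)" .
          moreover have "decay / sqrt 2 * (limit_shape x - y) = - (decay * ((y - limit_shape x) / sqrt 2))"
            by (simp add: right_diff_distrib diff_divide_distrib)
          ultimately show ?thesis by linarith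
        qed
        then have "exp (decay * e + decay / sqrt 2 * (limit_shape x - y)) < 1" by simp
        finally show ?thesis by simp
      qed
      have \<sigma>e: "0 < \<sigma> - e" and \<tau>e: "0 < \<tau> - e"
      proof -
        have "exp (- decay * (\<sigma> - e)) < 1" "exp (- decay * (\<tau> - e)) < 1"
          using outside exp_gt_zero[of "- decay * (\<sigma> - e)"] exp_gt_zero[of "- decay * (\<tau> - e)"] by linarith+
        then show "0 < \<sigma> - e" "0 < \<tau> - e" using decay_pos by (simp_all add: zero_less_mult_iff)
      qed
      define i0 where "i0 = nat \<lceil>(\<sigma> - e) * r\<rceil>"
      define j0 where "j0 = nat \<lceil>(\<tau> - e) * r\<rceil>"
      define k where "k = nat \<lfloor>h * r\<rfloor>"
      define p where "p m = nat \<lfloor>l m * r\<rfloor>" for m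
      define Sq where "Sq = {i0..i} \<times> {j0..j}"
      \<comment> \<open>Step \<open>m\<close> consists of the columns from \<open>m * k\<close> to \<open>m * k + k - 1\<close>.\<close>
      define St where "St = {(i, j). j < B * k \<and> i < p (j div k)}"
      have "Sq \<subseteq> cells (lam n)"
        using cells_down_closed[OF lam(1) ij(1)] by (auto simp: Sq_def)
      have St: "j' div k < B \<and> real i' < l (j' div k) * r \<and> real j' + 1 \<le> real (Suc (j' div k)) * h * r"
        if "(i', j') \<in> St" for i' j'
      proof -
        have j': "j' < B * k" and i': "i' < p (j' div k)" using that by (auto simp: St_def)
        then have k: "0 < k" by (cases k) auto
        have "j' div k < B" using j' by (simp add: less_mult_imp_div_less)
        moreover have "real i' < l (j' div k) * r" using i' unfolding p_def by linarith
        moreover have "real j' + 1 \<le> real (Suc (j' div k)) * h * r"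
        proof -
          have "Suc j' \<le> Suc (j' div k) * k"
            using dividend_less_div_times[OF k, of j'] by simp
          then have "real (Suc j') \<le> real (Suc (j' div k) * k)" by (rule of_nat_mono)
          then have "real j' + 1 \<le> real (Suc (j' div k)) * real k"
            by (simp only: of_nat_mult)
          also have "\<dots> \<le> real (Suc (j' div k)) * (h * r)"
            using hl r by (intro mult_left_mono) (auto simp: k_def of_nat_floor)
          finally show ?thesis by simp
        qed
        ultimately show ?thesis by blast
      qed
      have "St \<subseteq> cells (lam n)"
      proof (rule subrelI)
        fix i' j' assume "(i', j') \<in> St"
        from St[OF this] show "(i', j') \<in> cells (lam n)"
          by (intro inside[rule_format, of "j' div k"]) (simp_all add: r_def)
      qed
      moreover have "St \<inter> Sq = {}"
      proof (rule ccontr)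
        assume "St \<inter> Sq \<noteq> {}"
        then obtain i' j' where *: "(i', j') \<in> St" "i0 \<le> i'" "j0 \<le> j'" by (auto simp: Sq_def)
        define m where "m = j' div k"
        have "(\<sigma> - e) * r \<le> real i'" "(\<tau> - e) * r \<le> real j'"
          using * unfolding i0_def j0_def by linarith+
        then have "(\<sigma> - e) * r < l m * r" "(\<tau> - e) * r < real (Suc m) * h * r"
          using St[OF *(1)] by (auto simp: m_def)
        then have "\<sigma> - e < l m" "\<tau> - e < real (Suc m) * h" using r by simp_all
        then have "exp (- decay * l m) \<le> exp (- decay * (\<sigma> - e))"
            "exp (- decay * (real (Suc m) * h)) \<le> exp (- decay * (\<tau> - e))"
          using decay_pos by simp_all
        then show False using hl(3)[of m] outside by linarith
      qed
      moreover have "finite St" "finite Sq"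
        using \<open>St \<subseteq> _\<close> \<open>Sq \<subseteq> _\<close> finite_cells finite_subset by blast+
      ultimately have "card St + card Sq = card (St \<union> Sq)"
        by (intro card_Un_disjoint[symmetric])
      also have "\<dots> \<le> card (cells (lam n))"
        using \<open>St \<subseteq> _\<close> \<open>Sq \<subseteq> _\<close> by (intro card_mono finite_cells) auto
      finally have "card St + card Sq \<le> n" by (simp add: card_cells lam)
      moreover have "(e * r - 1)\<^sup>2 \<le> real (card Sq)"
      proof -
        have "e * r - 1 \<le> real (Suc i - i0)" "e * r - 1 \<le> real (Suc j - j0)"
          using corner mult_pos_pos[OF \<sigma>e r(1)] mult_pos_pos[OF \<tau>e r(1)]
          unfolding i0_def j0_def left_diff_distrib by linarith+
        moreover have "0 \<le> e * r - 1" using large r by (simp add: field_simps flip: r_def)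
        ultimately have "(e * r - 1) * (e * r - 1) \<le> real (Suc i - i0) * real (Suc j - j0)"
          by (intro mult_mono) auto
        then show ?thesis by (simp add: Sq_def power2_eq_square)
      qed
      moreover have "(h * r - 1) * (L * r - real B) \<le> real (card St)"
      proof -
        have "L * r - real B = (\<Sum>m<B. l m * r - 1)"
          by (simp add: L_def sum_subtractf sum_distrib_right)
        also have "\<dots> \<le> (\<Sum>m<B. real (p m))"
          unfolding p_def by (intro sum_mono) linarith
        finally have Lp: "L * r - real B \<le> (\<Sum>m<B. real (p m))" .
        have "0 \<le> h * r - 1" using large r by (simp add: field_simps flip: r_def)
        then have "(h * r - 1) * (L * r - real B) \<le> (h * r - 1) * (\<Sum>m<B. real (p m))"
          using Lp by (rule mult_left_mono[rotated])
        also have "\<dots> \<le> real k * (\<Sum>m<B. real (p m))"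
          unfolding k_def by (intro mult_right_mono sum_nonneg) linarith+
        also have "\<dots> = real (card St)" by (simp add: St_def card_stair_cells)
        finally show ?thesis .
      qed
      ultimately have "(h * r - 1) * (L * r - real B) + (e * r - 1)\<^sup>2 \<le> r * r"
        using r by linarith
      moreover have "r * r * ((h - 1 / r) * (L - real B / r) + (e - 1 / r)\<^sup>2)
          = (h * r - 1) * (L * r - real B) + (e * r - 1)\<^sup>2"
      proof -
        have "r * (h - 1 / r) = h * r - 1" "r * (L - real B / r) = L * r - real B" "r * (e - 1 / r) = e * r - 1"
          using r by (simp_all add: right_diff_distrib mult.commute)
        then show ?thesis
          by (simp only: power2_eq_square flip: \<open>r * (h - 1 / r) = _\<close> \<open>r * (L - real B / r) = _\<close> \<open>r * (e - 1 / r) = _\<close>)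
            (simp only: distrib_left mult_ac)
      qed
      moreover have "r * r * 1 < r * r * ((h - 1 / r) * (L - real B / r) + (e - 1 / r)\<^sup>2)"
        using large r by (intro mult_strict_left_mono) (auto simp: r_def)
      ultimately show False by linarith
    qed
  qed
qed

lemma two_decay: "2 * decay * sqrt (real n) = pi * sqrt (2 * real n / 3)"
proof -
  have "2 / sqrt 6 = sqrt (2 / 3)"
  proof -
    have "sqrt (2 / 3) = sqrt (4 / 6)" by simp
    also have "\<dots> = 2 / sqrt 6" by (simp only: real_sqrt_divide real_sqrt_four)
    finally show ?thesis by simp
  qed
  then have "pi * (2 / sqrt 6) * sqrt (real n) = pi * (sqrt (2 / 3) * sqrt (real n))" by simp
  also have "\<dots> = pi * sqrt (2 * real n / 3)" by (simp flip: real_sqrt_mult)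
  finally show ?thesis by (simp add: decay_def mult.commute)
qed

theorem theorem1p1:
  fixes lam :: "nat \<Rightarrow> nat list"
  assumes "\<And>n. n \<ge> 1 \<Longrightarrow> maximizes_subpartitions n (lam n)"
  shows "(\<exists>r. r \<in> o(\<lambda>n. sqrt (real n)) \<and>
            (\<forall>n\<ge>1. real (num_subpartitions (lam n)) = exp (pi * sqrt (2 * real n / 3) - r n)))
         \<and> uniform_limit UNIV (\<lambda>n. rescaled_boundary (lam n))
            (\<lambda>x. 2 * sqrt 3 / pi * ln (2 * cosh (pi / (2 * sqrt 3) * x))) sequentially"
proof
  have max: "\<forall>n\<ge>1. maximizes_subpartitions n (lam n)" using assms by blast
  define r where "r n = 2 * decay * sqrt (real n) - ln (real (num_subpartitions (lam n)))" for n
  have pos: "0 < real (num_subpartitions (lam n))" for n using num_subpartitions_pos by simp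
  have "r \<in> o(\<lambda>n. sqrt (real n))"
  proof (rule landau_o.smallI)
    fix c :: real assume c: "0 < c"
    show "\<forall>\<^sub>F n in sequentially. norm (r n) \<le> c * norm (sqrt (real n))"
      using maximizer_lower[OF max c] eventually_ge_at_top[of 1]
    proof eventually_elim
      case (elim n)
      have "(2 * decay - c) * sqrt (real n) \<le> ln (real (num_subpartitions (lam n)))"
        using elim(1) pos[of n] by (simp only: ln_ge_iff)
      moreover have "ln (real (num_subpartitions (lam n))) \<le> 2 * decay * sqrt (real n)"
      proof -
        have "partition_of n (lam n)"
          using max elim(2) by (simp add: maximizes_subpartitions_def)
        from ln_mono[OF num_subpartitions_le[OF this] pos] elim(2)
        show ?thesis by simp
      qed
      ultimately show ?case by (simp add: r_def algebra_simps)
    qed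
  qed
  moreover have "real (num_subpartitions (lam n)) = exp (pi * sqrt (2 * real n / 3) - r n)" for n
    using pos[of n] by (simp add: r_def flip: two_decay)
  ultimately show "\<exists>r. r \<in> o(\<lambda>n. sqrt (real n)) \<and>
            (\<forall>n\<ge>1. real (num_subpartitions (lam n)) = exp (pi * sqrt (2 * real n / 3) - r n))"
    by blast
  show "uniform_limit UNIV (\<lambda>n. rescaled_boundary (lam n))
            (\<lambda>x. 2 * sqrt 3 / pi * ln (2 * cosh (pi / (2 * sqrt 3) * x))) sequentially"
    unfolding limit_shape_def[symmetric] uniform_limit_iff
  proof (intro allI impI)
    fix e :: real assume "0 < e"
    then have e: "0 < e / 2" by simp
    from rescaled_boundary_lower[OF max e] rescaled_boundary_upper[OF max e]
    show "\<forall>\<^sub>F n in sequentially. \<forall>x\<in>UNIV. dist (rescaled_boundary (lam n) x) (limit_shape x) < e"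
    proof eventually_elim
      case (elim n)
      show ?case
      proof
        fix x
        show "dist (rescaled_boundary (lam n) x) (limit_shape x) < e"
          using elim(1)[rule_format, of x] elim(2)[rule_format, of x] \<open>0 < e\<close>
          by (simp add: dist_real_def abs_if)
      qed
    qed
  qed
qed

end
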